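(* Let $\mathbb K$ be a field of characteristic zero and let $\overline F_{\mathbb P}(1)$ be the $\mathbb K$-vector space with basis the isoclasses of finite posets (including the empty poset $1$), with the products $m,\downarrow,*$, the coproducts $\Delta,\Delta_*$ and the pairing $\langle\cdot,\cdot\rangle$ defined in the context. 1. $(\overline F_{\mathbb P}(1),*,\Delta)$ and $(\overline F_{\mathbb P}(1),m,\Delta_* )$ are dual bialgebras (with respect to $\langle\cdot,\cdot\rangle$). 2. $(\overline F_{\mathbb P}(1),\downarrow,\Delta_* )$ is an infinitesimal bialgebra.
   Context: $\lfloor\mathcal A\rfloor$ denotes the isoclass of a finite poset $\mathcal A=(A,\le_A)$. For subsets $P_1,P_2$ of a poset, $P_1<P_2$ means: for all $x\in P_1$, $y\in P_2$, $x\not\ge y$. Products (bilinear, unit $1$ = empty poset), for posets on disjoint sets $A,B$: - $m(\lfloor\mathcal A\rfloor,\lfloor\mathcal B\rfloor)=\lfloor\mathcal A\mathcal B\rfloor$, the disjoint union (no relations between $A$ and $B$); - $\lfloor\mathcal A\rfloor\downarrow\lfloor\mathcal B\rfloor=\lfloor\mathcal A\downarrow\mathcal B\rfloor$, where $\mathcal A\downarrow\mathcal B$ is $A\sqcup B$ with the orders of $\mathcal A$, $\mathcal B$ and $x\le y$ for all $x\in A$, $y\in B$; - $\lfloor\mathcal A\rfloor*\lfloor\mathcal B\rfloor$ is the sum of $\lfloor\mathcal C\rfloor$ over all partial orders $\mathcal C$ on $A\sqcup B$ restricting to $\le_A$ on $A$ and to $\le_B$ on $B$ and such that $A<B$ in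 $\mathcal C$. Coproducts: if $\mathcal A=\mathcal A_1\cdots\mathcal A_k$ is the decomposition into connected components (of the Hasse diagram), $\Delta(\lfloor\mathcal A\rfloor)=\sum_{I\subseteq\{1,\dots,k\}}\lfloor\prod_{i\in I}\mathcal A_i\rfloor\otimes\lfloor\prod_{i\notin I}\mathcal A_i\rfloor$; and $\Delta_*(\lfloor\mathcal A\rfloor)=\sum_{I\subseteq A,\ A\setminus I<I}\lfloor\mathcal A_{|A\setminus I}\rfloor\otimes\lfloor\mathcal A_{|I}\rfloor$. The counit sends the empty poset to $1$ and other isoclasses to $0$. Pairing: $\langle\lfloor\mathcal A\rfloor,\lfloor\mathcal B\rfloor\rangle=s_{\lfloor\mathcal A\rfloor}\,\delta_{\lfloor\mathcal A\rfloor,\lfloor\mathcal B\rfloor}$ where $s_{\lfloor\mathcal A\rfloor}$ is the number of poset automorphisms of $\mathcal A$; it identifies $\overline F_{\mathbb P}(1)$ (graded by cardinality) with its graded dual. "Dual bialgebras" means that each product is adjoint, via the pairing, to the coproduct of the other: $\langle x*y,z\rangle=\langle x\otimes y,\Delta_*(z)\rangle$ and $\langle m(x,y),z\rangle=\langle x\otimes y,\Delta(z)\rangle$. An infinitesimal bialgebra (in the sense of Loday–Ronco) is a unital associative algebra and counital coassociative coalgebra $(H,\cdot,\Delta)$ with $\Delta(x\cdot y)=\Delta(x)\cdot(1\otimes y)+(x\otimes1)\cdot\Delta(y)-x\otimes y$ for all $x,y$. *)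

theory Defs
  imports Complex_Main "HOL-Library.Poly_Mapping" "HOL-Library.FuncSet"
begin

section \<open>Finite posets and their isoclasses\<close>

text \<open>A partial order relation is reflexive, so it determines its carrier as its field; the empty
  relation is the empty poset.\<close>

definition fposet :: "'a rel \<Rightarrow> bool" where
  "fposet r \<longleftrightarrow> finite (Field r) \<and> Partial_order r"

definition is_iso :: "'a rel \<Rightarrow> 'b rel \<Rightarrow> ('a \<Rightarrow> 'b) \<Rightarrow> bool" where
  "is_iso r s f \<longleftrightarrow> bij_betw f (Field r) (Field s) \<and>
     (\<forall>x\<in>Field r. \<forall>y\<in>Field r. (x, y) \<in> r \<longleftrightarrow> (f x, f y) \<in> s)"

definition poset_iso :: "'a rel \<Rightarrow> 'b rel \<Rightarrow> bool" where
  "poset_iso r s \<longleftrightarrow> fposet r \<and> fposet s \<and> (\<exists>f. is_iso r s f)"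

lemma Field_map_prod: "Field (map_prod f f ` r) = f ` Field r"
  by (auto simp: Field_def Domain_iff Range_iff image_iff)

lemma is_iso_iff: "is_iso r s f \<longleftrightarrow> inj_on f (Field r) \<and> s = map_prod f f ` r"
proof
  assume "is_iso r s f"
  then have b: "inj_on f (Field r)" "f ` Field r = Field s"
    and o: "\<And>x y. x \<in> Field r \<Longrightarrow> y \<in> Field r \<Longrightarrow> (x, y) \<in> r \<longleftrightarrow> (f x, f y) \<in> s"
    by (auto simp: is_iso_def bij_betw_def)
  have "map_prod f f ` r \<subseteq> s"
  proof clarsimp
    fix x y assume xy: "(x, y) \<in> r"
    then have "x \<in> Field r" "y \<in> Field r" by (auto intro: FieldI1 FieldI2)
    then show "(f x, f y) \<in> s" using o xy by blast
  qed
  moreover have "s \<subseteq> map_prod f f ` r"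
  proof clarify
    fix u v assume uv: "(u, v) \<in> s"
    then have "u \<in> f ` Field r" "v \<in> f ` Field r"
      unfolding b(2) by (auto intro: FieldI1 FieldI2)
    then obtain x y where xy: "x \<in> Field r" "y \<in> Field r" "u = f x" "v = f y" by auto
    then have "(x, y) \<in> r" using uv o by blast
    moreover have "(u, v) = map_prod f f (x, y)" using xy by simp
    ultimately have "(x, y) \<in> r" "(u, v) = map_prod f f (x, y)" by simp_all
    then show "(u, v) \<in> map_prod f f ` r" by blast
  qed
  ultimately show "inj_on f (Field r) \<and> s = map_prod f f ` r" using b(1) by auto
next
  assume a: "inj_on f (Field r) \<and> s = map_prod f f ` r"
  then have fs: "Field s = f ` Field r"
    by (simp add: Field_map_prod)
  have "(x, y) \<in> r \<longleftrightarrow> (f x, f y) \<in> s" if "x \<in> Field r" "y \<in> Field r" for x y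
  proof
    assume "(x, y) \<in> r"
    then have "map_prod f f (x, y) \<in> map_prod f f ` r" by (rule imageI)
    then show "(f x, f y) \<in> s" using a by simp
  next
    assume "(f x, f y) \<in> s"
    then obtain u v where "(u, v) \<in> r" "f x = f u" "f y = f v" using a by auto
    then show "(x, y) \<in> r" using a that by (metis FieldI1 FieldI2 inj_onD)
  qed
  then show "is_iso r s f" using a fs by (auto simp: is_iso_def bij_betw_def)
qed

lemma fposet_iff:
  "fposet r \<longleftrightarrow> finite (Field r) \<and> (\<forall>x\<in>Field r. (x, x) \<in> r) \<and> trans r \<and> antisym r"
  by (auto simp: fposet_def order_on_defs refl_on_def intro: FieldI1 FieldI2)

lemma fposet_is_iso:
  assumes "fposet r" "is_iso r s f"
  shows "fposet s"
proof -
  have F: "f ` Field r = Field s" using assms(2) by (simp add: is_iso_def bij_betw_def)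
  have o: "(f x, f y) \<in> s \<longleftrightarrow> (x, y) \<in> r" if "x \<in> Field r" "y \<in> Field r" for x y
    using assms(2) that unfolding is_iso_def by blast
  have r: "finite (Field r)" "\<And>x. x \<in> Field r \<Longrightarrow> (x, x) \<in> r" "trans r" "antisym r"
    using assms(1) by (auto simp: fposet_iff)
  have ex: "\<exists>x\<in>Field r. u = f x" if "u \<in> Field s" for u using F that by blast
  have "trans s"
  proof (rule transI)
    fix u v w assume uv: "(u, v) \<in> s" "(v, w) \<in> s"
    then have "u \<in> Field s" "v \<in> Field s" "w \<in> Field s" by (auto intro: FieldI1 FieldI2)
    then obtain x y z where xyz: "x \<in> Field r" "y \<in> Field r" "z \<in> Field r"
      "u = f x" "v = f y" "w = f z" using ex by metis
    then have "(x, y) \<in> r" "(y, z) \<in> r" using uv o by blast+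
    then have "(x, z) \<in> r" using r(3) by (meson transD)
    then show "(u, w) \<in> s" using xyz o by blast
  qed
  moreover have "antisym s"
  proof (rule antisymI)
    fix u v assume uv: "(u, v) \<in> s" "(v, u) \<in> s"
    then have "u \<in> Field s" "v \<in> Field s" by (auto intro: FieldI1 FieldI2)
    then obtain x y where xyz: "x \<in> Field r" "y \<in> Field r" "u = f x" "v = f y" using ex by metis
    then have "(x, y) \<in> r" "(y, x) \<in> r" using uv o by blast+
    then show "u = v" using r(4) xyz by (metis antisymD)
  qed
  moreover have "(u, u) \<in> s" if "u \<in> Field s" for u
    using ex[OF that] o r(2) by blast
  moreover have "finite (Field s)" using F r(1) by (metis finite_imageI)
  ultimately show ?thesis by (simp add: fposet_iff)
qed

lemma fposet_map_prod: "fposet r \<Longrightarrow> inj_on f (Field r) \<Longrightarrow> fposet (map_prod f f ` r)"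
  using fposet_is_iso[of r "map_prod f f ` r" f] by (simp add: is_iso_iff)

lemma poset_iso_iff:
  "poset_iso r s \<longleftrightarrow> fposet r \<and> (\<exists>f. inj_on f (Field r) \<and> s = map_prod f f ` r)"
  unfolding poset_iso_def is_iso_iff using fposet_map_prod by blast

lemma poset_iso_refl: "fposet r \<Longrightarrow> poset_iso r r"
  unfolding poset_iso_def is_iso_def using bij_betw_id by fastforce

lemma poset_iso_sym:
  assumes "poset_iso r s" shows "poset_iso s r"
proof -
  obtain f where f: "is_iso r s f" using assms by (auto simp: poset_iso_def)
  have b: "bij_betw f (Field r) (Field s)" using f by (simp add: is_iso_def)
  let ?g = "inv_into (Field r) f"
  have g: "bij_betw ?g (Field s) (Field r)" using b by (rule bij_betw_inv_into)
  have "is_iso s r ?g"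
    unfolding is_iso_def
  proof (intro conjI ballI g)
    fix x y assume xy: "x \<in> Field s" "y \<in> Field s"
    then have "?g x \<in> Field r" "?g y \<in> Field r" "f (?g x) = x" "f (?g y) = y"
      using g b by (auto dest: bij_betwE simp: bij_betw_inv_into_right)
    then show "(x, y) \<in> s \<longleftrightarrow> (?g x, ?g y) \<in> r"
      using f by (metis is_iso_def)
  qed
  then show ?thesis using assms by (auto simp: poset_iso_def)
qed

lemma poset_iso_trans:
  assumes "poset_iso r s" "poset_iso s t" shows "poset_iso r t"
proof -
  obtain f g where f: "is_iso r s f" "is_iso s t g" using assms by (auto simp: poset_iso_def)
  have "is_iso r t (g \<circ> f)"
    unfolding is_iso_def
  proof (intro conjI ballI)
    show "bij_betw (g \<circ> f) (Field r) (Field t)"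
      using f by (auto simp: is_iso_def intro: bij_betw_trans)
  next
    fix x y assume "x \<in> Field r" "y \<in> Field r"
    then show "(x, y) \<in> r \<longleftrightarrow> ((g \<circ> f) x, (g \<circ> f) y) \<in> t"
      using f by (auto simp: is_iso_def dest: bij_betwE)
  qed
  then show ?thesis using assms by (auto simp: poset_iso_def)
qed

lemma fposet_empty: "fposet {}"
  by (simp add: fposet_def)

quotient_type poset_class = "nat rel" / partial: "poset_iso :: nat rel \<Rightarrow> nat rel \<Rightarrow> bool"
proof (rule part_equivpI)
  show "\<exists>r :: nat rel. poset_iso r r"
    using poset_iso_refl[OF fposet_empty] by blast
  show "symp (poset_iso :: nat rel \<Rightarrow> nat rel \<Rightarrow> bool)"
    by (auto intro: sympI poset_iso_sym)
  show "transp (poset_iso :: nat rel \<Rightarrow> nat rel \<Rightarrow> bool)"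
    by (auto intro: transpI poset_iso_trans)
qed

definition iso_class :: "'a rel \<Rightarrow> poset_class" where
  "iso_class r = abs_poset_class (SOME s :: nat rel. poset_iso r s)"

lemma ex_nat_copy:
  assumes "fposet r" shows "\<exists>s :: nat rel. poset_iso r s"
proof -
  have "finite (Field r)" using assms by (simp add: fposet_def)
  then obtain f :: "'a \<Rightarrow> nat" where "inj_on f (Field r)"
    using finite_imp_inj_to_nat_seg by blast
  then show ?thesis using assms by (auto simp: poset_iso_iff)
qed

lemma poset_iso_rep_abs:
  assumes "poset_iso s s" shows "poset_iso (rep_poset_class (abs_poset_class s)) s"
  using rep_abs_rsp_left[OF Quotient3_poset_class] assms by (meson Quotient3_poset_class Quotient3_rep_abs)

lemma poset_iso_rep_iso_class:
  assumes "fposet r" shows "poset_iso (rep_poset_class (iso_class r)) r"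
proof -
  let ?s = "SOME s :: nat rel. poset_iso r s"
  have s: "poset_iso r ?s" using someI_ex[OF ex_nat_copy[OF assms]] .
  then have "poset_iso ?s ?s" using poset_iso_sym poset_iso_trans by blast
  then show ?thesis
    unfolding iso_class_def using poset_iso_rep_abs s poset_iso_sym poset_iso_trans by blast
qed

lemma fposet_rep: "fposet (rep_poset_class p)"
  using Quotient3_rep_reflp[OF Quotient3_poset_class] by (auto simp: poset_iso_def)

theorem iso_class_eq_iff:
  assumes "fposet r" "fposet s"
  shows "iso_class r = iso_class s \<longleftrightarrow> poset_iso r s"
proof
  assume "iso_class r = iso_class s"
  then show "poset_iso r s"
    using poset_iso_rep_iso_class[OF assms(1)] poset_iso_rep_iso_class[OF assms(2)]
      poset_iso_sym poset_iso_trans by metis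
next
  assume "poset_iso r s"
  then have "poset_iso (rep_poset_class (iso_class r)) (rep_poset_class (iso_class s))"
    using poset_iso_rep_iso_class[OF assms(1)] poset_iso_rep_iso_class[OF assms(2)]
      poset_iso_sym poset_iso_trans by metis
  then show "iso_class r = iso_class s"
    using Quotient3_rel_rep[OF Quotient3_poset_class] by blast
qed

lemma iso_class_eqI: "poset_iso r s \<Longrightarrow> iso_class r = iso_class s"
  using iso_class_eq_iff by (auto simp: poset_iso_def)

theorem iso_class_rep [simp]: "iso_class (rep_poset_class p) = p"
  using poset_iso_rep_iso_class[OF fposet_rep] Quotient3_rel_rep[OF Quotient3_poset_class] by blast


section \<open>Operations on posets\<close>

definition before :: "'a rel \<Rightarrow> 'a set \<Rightarrow> 'a set \<Rightarrow> bool" where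
  "before r P Q \<longleftrightarrow> (\<forall>x\<in>P. \<forall>y\<in>Q. (y, x) \<notin> r)"

definition disj_union :: "'a rel \<Rightarrow> 'b rel \<Rightarrow> ('a + 'b) rel" where
  "disj_union r s = map_prod Inl Inl ` r \<union> map_prod Inr Inr ` s"

definition ord_sum :: "'a rel \<Rightarrow> 'b rel \<Rightarrow> ('a + 'b) rel" where
  "ord_sum r s = disj_union r s \<union> (Inl ` Field r) \<times> (Inr ` Field s)"

definition star_orders :: "'a rel \<Rightarrow> 'b rel \<Rightarrow> ('a + 'b) rel set" where
  "star_orders r s = {t. partial_order_on (Field r <+> Field s) t \<and>
     Restr t (Inl ` Field r) = map_prod Inl Inl ` r \<and>
     Restr t (Inr ` Field s) = map_prod Inr Inr ` s \<and>
     before t (Inl ` Field r) (Inr ` Field s)}"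

definition hasse :: "'a rel \<Rightarrow> 'a rel" where
  "hasse r = {(x, y) \<in> r. x \<noteq> y \<and> (\<forall>z. (x, z) \<in> r \<and> (z, y) \<in> r \<longrightarrow> z = x \<or> z = y)}"

definition components :: "'a rel \<Rightarrow> 'a set set" where
  "components r = Field r // Restr ((hasse r \<union> (hasse r)\<inverse>)\<^sup>*) (Field r)"

definition num_aut :: "'a rel \<Rightarrow> nat" where
  "num_aut r = card {f \<in> extensional (Field r). is_iso r r f}"


section \<open>Vector spaces with a basis\<close>

text \<open>The space with basis \<open>'a\<close> is \<open>'a \<Rightarrow>\<^sub>0 'k\<close>, and the tensor product of the spaces with
  bases \<open>'a\<close> and \<open>'b\<close> is the space with basis \<open>'a \<times> 'b\<close>.\<close>

definition scl :: "'k::field \<Rightarrow> ('a \<Rightarrow>\<^sub>0 'k) \<Rightarrow> ('a \<Rightarrow>\<^sub>0 'k)" where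
  "scl c = Poly_Mapping.map ((*) c)"

definition basis :: "'a \<Rightarrow> ('a \<Rightarrow>\<^sub>0 'k::field)" where
  "basis a = Poly_Mapping.single a 1"

definition lin_ext :: "('a \<Rightarrow> ('b \<Rightarrow>\<^sub>0 'k)) \<Rightarrow> ('a \<Rightarrow>\<^sub>0 'k) \<Rightarrow> ('b \<Rightarrow>\<^sub>0 'k::field)" where
  "lin_ext f x = (\<Sum>a\<in>Poly_Mapping.keys x. scl (Poly_Mapping.lookup x a) (f a))"

definition bilin_ext ::
  "('a \<Rightarrow> 'b \<Rightarrow> ('c \<Rightarrow>\<^sub>0 'k)) \<Rightarrow> ('a \<Rightarrow>\<^sub>0 'k) \<Rightarrow> ('b \<Rightarrow>\<^sub>0 'k) \<Rightarrow> ('c \<Rightarrow>\<^sub>0 'k::field)" where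
  "bilin_ext f x y = lin_ext (\<lambda>a. lin_ext (f a) y) x"

definition lin_form :: "('a \<Rightarrow> 'k) \<Rightarrow> ('a \<Rightarrow>\<^sub>0 'k) \<Rightarrow> 'k::field" where
  "lin_form f x = (\<Sum>a\<in>Poly_Mapping.keys x. Poly_Mapping.lookup x a * f a)"

definition bilin_form :: "('a \<Rightarrow> 'b \<Rightarrow> 'k) \<Rightarrow> ('a \<Rightarrow>\<^sub>0 'k) \<Rightarrow> ('b \<Rightarrow>\<^sub>0 'k) \<Rightarrow> 'k::field" where
  "bilin_form f x y = lin_form (\<lambda>a. lin_form (f a) y) x"

definition tens :: "('a \<Rightarrow>\<^sub>0 'k) \<Rightarrow> ('b \<Rightarrow>\<^sub>0 'k) \<Rightarrow> ('a \<times> 'b \<Rightarrow>\<^sub>0 'k::field)" where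
  "tens = bilin_ext (\<lambda>a b. basis (a, b))"

text \<open>\<open>tmap F G\<close> is \<open>F \<otimes> G\<close> for linear \<open>F\<close>, \<open>G\<close>.\<close>

definition tmap :: "(('a \<Rightarrow>\<^sub>0 'k) \<Rightarrow> ('c \<Rightarrow>\<^sub>0 'k)) \<Rightarrow> (('b \<Rightarrow>\<^sub>0 'k) \<Rightarrow> ('d \<Rightarrow>\<^sub>0 'k)) \<Rightarrow>
    ('a \<times> 'b \<Rightarrow>\<^sub>0 'k) \<Rightarrow> ('c \<times> 'd \<Rightarrow>\<^sub>0 'k::field)" where
  "tmap F G = lin_ext (\<lambda>(a, b). tens (F (basis a)) (G (basis b)))"

definition tassoc :: "(('a \<times> 'b) \<times> 'c \<Rightarrow>\<^sub>0 'k) \<Rightarrow> ('a \<times> 'b \<times> 'c \<Rightarrow>\<^sub>0 'k::field)" where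
  "tassoc = lin_ext (\<lambda>((a, b), c). basis (a, b, c))"

text \<open>The product of \<open>H \<otimes> H\<close> given by \<open>(x \<otimes> y) (x' \<otimes> y') = x x' \<otimes> y y'\<close>.\<close>

definition tmul :: "(('a \<Rightarrow>\<^sub>0 'k) \<Rightarrow> ('a \<Rightarrow>\<^sub>0 'k) \<Rightarrow> ('a \<Rightarrow>\<^sub>0 'k)) \<Rightarrow>
    ('a \<times> 'a \<Rightarrow>\<^sub>0 'k) \<Rightarrow> ('a \<times> 'a \<Rightarrow>\<^sub>0 'k) \<Rightarrow> ('a \<times> 'a \<Rightarrow>\<^sub>0 'k::field)" where
  "tmul M = bilin_ext (\<lambda>(a, b) (c, d). tens (M (basis a) (basis c)) (M (basis b) (basis d)))"

text \<open>The bilinear form on \<open>H \<otimes> H\<close> with \<open>\<langle>x \<otimes> y, x' \<otimes> y'\<rangle> = \<langle>x, x'\<rangle> \<langle>y, y'\<rangle>\<close>.\<close>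

definition tform :: "(('a \<Rightarrow>\<^sub>0 'k) \<Rightarrow> ('a \<Rightarrow>\<^sub>0 'k) \<Rightarrow> 'k) \<Rightarrow>
    ('a \<times> 'a \<Rightarrow>\<^sub>0 'k) \<Rightarrow> ('a \<times> 'a \<Rightarrow>\<^sub>0 'k) \<Rightarrow> 'k::field" where
  "tform B = bilin_form (\<lambda>(a, b) (c, d). B (basis a) (basis c) * B (basis b) (basis d))"

lemma lookup_scl [simp]: "Poly_Mapping.lookup (scl c x) a = c * Poly_Mapping.lookup x a"
  by (simp add: scl_def map.rep_eq when_def)

lemma vector_space_scl: "vector_space scl"
  by unfold_locales (auto intro!: poly_mapping_eqI simp: lookup_add algebra_simps)

lemma lookup_basis: "Poly_Mapping.lookup (basis a) b = (if a = b then 1 else 0)"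
  by (simp add: basis_def lookup_single when_def)

lemma lin_ext_basis [simp]: "lin_ext f (basis a) = f a"
proof -
  have "scl 1 (f a) = f a" by (rule poly_mapping_eqI) simp
  then show ?thesis by (simp add: lin_ext_def basis_def)
qed

lemma bilin_ext_basis [simp]: "bilin_ext f (basis a) (basis b) = f a b"
  by (simp add: bilin_ext_def)

lemma lin_form_basis [simp]: "lin_form f (basis a) = f a"
  by (simp add: lin_form_def basis_def)

lemma bilin_form_basis [simp]: "bilin_form f (basis a) (basis b) = f a b"
  by (simp add: bilin_form_def)


section \<open>Bialgebras, dual bialgebras, infinitesimal bialgebras\<close>

definition unital_algebra ::
  "(('a \<Rightarrow>\<^sub>0 'k) \<Rightarrow> ('a \<Rightarrow>\<^sub>0 'k) \<Rightarrow> ('a \<Rightarrow>\<^sub>0 'k)) \<Rightarrow> ('a \<Rightarrow>\<^sub>0 'k::field) \<Rightarrow> bool" where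
  "unital_algebra M u \<longleftrightarrow>
     (\<forall>x. Vector_Spaces.linear scl scl (M x)) \<and>
     (\<forall>y. Vector_Spaces.linear scl scl (\<lambda>x. M x y)) \<and>
     (\<forall>x y z. M (M x y) z = M x (M y z)) \<and>
     (\<forall>x. M u x = x \<and> M x u = x)"

text \<open>The counit axiom uses the identification of \<open>K \<otimes> H\<close> and \<open>H \<otimes> K\<close> with \<open>H\<close>.\<close>

definition counital_coalgebra ::
  "(('a \<Rightarrow>\<^sub>0 'k) \<Rightarrow> ('a \<times> 'a \<Rightarrow>\<^sub>0 'k)) \<Rightarrow> (('a \<Rightarrow>\<^sub>0 'k) \<Rightarrow> 'k::field) \<Rightarrow> bool" where
  "counital_coalgebra D e \<longleftrightarrow>
     Vector_Spaces.linear scl scl D \<and>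
     Vector_Spaces.linear scl (*) e \<and>
     (\<forall>x. tassoc (tmap D id (D x)) = tmap id D (D x)) \<and>
     (\<forall>x. lin_ext (\<lambda>(a, b). scl (e (basis a)) (basis b)) (D x) = x) \<and>
     (\<forall>x. lin_ext (\<lambda>(a, b). scl (e (basis b)) (basis a)) (D x) = x)"

definition bialgebra ::
  "(('a \<Rightarrow>\<^sub>0 'k) \<Rightarrow> ('a \<Rightarrow>\<^sub>0 'k) \<Rightarrow> ('a \<Rightarrow>\<^sub>0 'k)) \<Rightarrow> ('a \<Rightarrow>\<^sub>0 'k) \<Rightarrow>
   (('a \<Rightarrow>\<^sub>0 'k) \<Rightarrow> ('a \<times> 'a \<Rightarrow>\<^sub>0 'k)) \<Rightarrow> (('a \<Rightarrow>\<^sub>0 'k) \<Rightarrow> 'k::field) \<Rightarrow> bool" where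
  "bialgebra M u D e \<longleftrightarrow>
     unital_algebra M u \<and> counital_coalgebra D e \<and>
     (\<forall>x y. D (M x y) = tmul M (D x) (D y)) \<and> D u = tens u u \<and>
     (\<forall>x y. e (M x y) = e x * e y) \<and> e u = 1"

definition infinitesimal_bialgebra ::
  "(('a \<Rightarrow>\<^sub>0 'k) \<Rightarrow> ('a \<Rightarrow>\<^sub>0 'k) \<Rightarrow> ('a \<Rightarrow>\<^sub>0 'k)) \<Rightarrow> ('a \<Rightarrow>\<^sub>0 'k) \<Rightarrow>
   (('a \<Rightarrow>\<^sub>0 'k) \<Rightarrow> ('a \<times> 'a \<Rightarrow>\<^sub>0 'k)) \<Rightarrow> (('a \<Rightarrow>\<^sub>0 'k) \<Rightarrow> 'k::field) \<Rightarrow> bool" where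
  "infinitesimal_bialgebra M u D e \<longleftrightarrow>
     unital_algebra M u \<and> counital_coalgebra D e \<and>
     (\<forall>x y. D (M x y) = tmul M (D x) (tens u y) + tmul M (tens x u) (D y) - tens x y)"

definition dual_bialgebras ::
  "(('a \<Rightarrow>\<^sub>0 'k) \<Rightarrow> ('a \<Rightarrow>\<^sub>0 'k) \<Rightarrow> 'k) \<Rightarrow>
   (('a \<Rightarrow>\<^sub>0 'k) \<Rightarrow> ('a \<Rightarrow>\<^sub>0 'k) \<Rightarrow> ('a \<Rightarrow>\<^sub>0 'k)) \<Rightarrow> ('a \<Rightarrow>\<^sub>0 'k) \<Rightarrow>
   (('a \<Rightarrow>\<^sub>0 'k) \<Rightarrow> ('a \<times> 'a \<Rightarrow>\<^sub>0 'k)) \<Rightarrow> (('a \<Rightarrow>\<^sub>0 'k) \<Rightarrow> 'k) \<Rightarrow>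
   (('a \<Rightarrow>\<^sub>0 'k) \<Rightarrow> ('a \<Rightarrow>\<^sub>0 'k) \<Rightarrow> ('a \<Rightarrow>\<^sub>0 'k)) \<Rightarrow> ('a \<Rightarrow>\<^sub>0 'k) \<Rightarrow>
   (('a \<Rightarrow>\<^sub>0 'k) \<Rightarrow> ('a \<times> 'a \<Rightarrow>\<^sub>0 'k)) \<Rightarrow> (('a \<Rightarrow>\<^sub>0 'k) \<Rightarrow> 'k::field) \<Rightarrow> bool" where
  "dual_bialgebras B M u D e M' u' D' e' \<longleftrightarrow>
     bialgebra M u D e \<and> bialgebra M' u' D' e' \<and>
     (\<forall>x y z. B (M x y) z = tform B (tens x y) (D' z)) \<and>
     (\<forall>x y z. B (M' x y) z = tform B (tens x y) (D z))"


section \<open>The space of isoclasses of finite posets\<close>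

type_synonym 'k poset_space = "poset_class \<Rightarrow>\<^sub>0 'k"
type_synonym 'k poset_space2 = "poset_class \<times> poset_class \<Rightarrow>\<^sub>0 'k"

definition unit_poset :: "'k::field poset_space" where
  "unit_poset = basis (iso_class ({} :: nat rel))"

definition prod_m :: "'k poset_space \<Rightarrow> 'k poset_space \<Rightarrow> 'k::field poset_space" where
  "prod_m = bilin_ext (\<lambda>p q.
     basis (iso_class (disj_union (rep_poset_class p) (rep_poset_class q))))"

definition prod_down :: "'k poset_space \<Rightarrow> 'k poset_space \<Rightarrow> 'k::field poset_space" where
  "prod_down = bilin_ext (\<lambda>p q.
     basis (iso_class (ord_sum (rep_poset_class p) (rep_poset_class q))))"

definition prod_star :: "'k poset_space \<Rightarrow> 'k poset_space \<Rightarrow> 'k::field poset_space" where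
  "prod_star = bilin_ext (\<lambda>p q.
     \<Sum>t\<in>star_orders (rep_poset_class p) (rep_poset_class q). basis (iso_class t))"

text \<open>The product of the components in \<open>I\<close> is the union of the restrictions of the order to them.\<close>

definition coprod_of :: "'a rel \<Rightarrow> 'k::field poset_space2" where
  "coprod_of r = (\<Sum>I\<in>Pow (components r).
     basis (iso_class (\<Union>C\<in>I. Restr r C), iso_class (\<Union>C\<in>components r - I. Restr r C)))"

definition coprod_star_of :: "'a rel \<Rightarrow> 'k::field poset_space2" where
  "coprod_star_of r = (\<Sum>I | I \<subseteq> Field r \<and> before r (Field r - I) I.
     basis (iso_class (Restr r (Field r - I)), iso_class (Restr r I)))"

definition coprod :: "'k poset_space \<Rightarrow> 'k::field poset_space2" where
  "coprod = lin_ext (\<lambda>p. coprod_of (rep_poset_class p))"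

definition coprod_star :: "'k poset_space \<Rightarrow> 'k::field poset_space2" where
  "coprod_star = lin_ext (\<lambda>p. coprod_star_of (rep_poset_class p))"

definition counit :: "'k poset_space \<Rightarrow> 'k::field" where
  "counit = lin_form (\<lambda>p. if p = iso_class ({} :: nat rel) then 1 else 0)"

definition pairing :: "'k poset_space \<Rightarrow> 'k poset_space \<Rightarrow> 'k::field" where
  "pairing = bilin_form (\<lambda>p q. if p = q then of_nat (num_aut (rep_poset_class p)) else 0)"


section \<open>Independence of representatives\<close>

text \<open>The operations above are computed on chosen representatives; any others give the same result.\<close>

lemma is_isoD:
  assumes "is_iso r s f"
  shows "bij_betw f (Field r) (Field s)" "inj_on f (Field r)" "f ` Field r = Field s"
    "\<And>x. x \<in> Field r \<Longrightarrow> f x \<in> Field s"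
    "\<And>x y. x \<in> Field r \<Longrightarrow> y \<in> Field r \<Longrightarrow> (f x, f y) \<in> s \<longleftrightarrow> (x, y) \<in> r"
    "s = map_prod f f ` r"
proof -
  show b: "bij_betw f (Field r) (Field s)" using assms by (simp add: is_iso_def)
  then show "inj_on f (Field r)" "f ` Field r = Field s" by (auto simp: bij_betw_def)
  then show "\<And>x. x \<in> Field r \<Longrightarrow> f x \<in> Field s" by blast
  show "\<And>x y. x \<in> Field r \<Longrightarrow> y \<in> Field r \<Longrightarrow> (f x, f y) \<in> s \<longleftrightarrow> (x, y) \<in> r"
    using assms unfolding is_iso_def by blast
  show "s = map_prod f f ` r" using assms by (simp add: is_iso_iff)
qed

lemma is_isoI:
  assumes "bij_betw f (Field r) (Field s)"
    "\<And>x y. x \<in> Field r \<Longrightarrow> y \<in> Field r \<Longrightarrow> (f x, f y) \<in> s \<longleftrightarrow> (x, y) \<in> r"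
  shows "is_iso r s f"
  using assms unfolding is_iso_def by blast

lemma poset_isoI: "fposet r \<Longrightarrow> is_iso r s f \<Longrightarrow> poset_iso r s"
  using fposet_is_iso[of r s f] unfolding poset_iso_def by blast

lemma poset_isoE:
  assumes "poset_iso r s"
  obtains f where "is_iso r s f" "fposet r" "fposet s"
  using assms unfolding poset_iso_def by blast

lemma is_iso_inverse:
  assumes "is_iso r s f"
  obtains g where "is_iso s r g" "\<And>x. x \<in> Field r \<Longrightarrow> g (f x) = x"
    "\<And>y. y \<in> Field s \<Longrightarrow> f (g y) = y"
proof
  let ?g = "inv_into (Field r) f"
  note f = is_isoD[OF assms]
  show gf: "?g (f x) = x" if "x \<in> Field r" for x using f(2) that by simp
  show fg: "f (?g y) = y" if "y \<in> Field s" for y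
    using f(3) that by (metis f_inv_into_f)
  have g: "bij_betw ?g (Field s) (Field r)" using f(1) by (rule bij_betw_inv_into)
  then have gin: "?g y \<in> Field r" if "y \<in> Field s" for y using that by (auto dest: bij_betwE)
  show "is_iso s r ?g"
  proof (rule is_isoI[OF g])
    fix x y assume "x \<in> Field s" "y \<in> Field s"
    then show "(?g x, ?g y) \<in> r \<longleftrightarrow> (x, y) \<in> s" using f(5)[OF gin gin] fg by metis
  qed
qed

lemma mem_Plus_iff [simp]:
  "Inl a \<in> A <+> B \<longleftrightarrow> a \<in> A" "Inr b \<in> A <+> B \<longleftrightarrow> b \<in> B"
  by auto

lemma Field_disj_union [simp]: "Field (disj_union r s) = Field r <+> Field s"
  unfolding disj_union_def Field_Un Field_map_prod by auto

lemma Field_ord_sum [simp]: "Field (ord_sum r s) = Field r <+> Field s"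
proof -
  have "Field (ord_sum r s) = (Field r <+> Field s) \<union> Field ((Inl ` Field r) \<times> (Inr ` Field s))"
    unfolding ord_sum_def Field_Un by simp
  moreover have "Field ((Inl ` Field r) \<times> (Inr ` Field s)) \<subseteq> Field r <+> Field s"
    unfolding Field_def by auto
  ultimately show ?thesis by blast
qed

lemma disj_union_simps [simp]:
  "(Inl a, Inl b) \<in> disj_union r s \<longleftrightarrow> (a, b) \<in> r"
  "(Inr c, Inr d) \<in> disj_union r s \<longleftrightarrow> (c, d) \<in> s"
  "(Inl a, Inr d) \<notin> disj_union r s"
  "(Inr c, Inl b) \<notin> disj_union r s"
  by (auto simp: disj_union_def)

lemma ord_sum_simps [simp]:
  "(Inl a, Inl b) \<in> ord_sum r s \<longleftrightarrow> (a, b) \<in> r"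
  "(Inr c, Inr d) \<in> ord_sum r s \<longleftrightarrow> (c, d) \<in> s"
  "(Inl a, Inr d) \<in> ord_sum r s \<longleftrightarrow> a \<in> Field r \<and> d \<in> Field s"
  "(Inr c, Inl b) \<notin> ord_sum r s"
  by (auto simp: ord_sum_def)

lemma fposet_disj_union:
  assumes "fposet r" "fposet s" shows "fposet (disj_union r s)"
proof -
  have r: "\<And>a b c. (a, b) \<in> r \<Longrightarrow> (b, c) \<in> r \<Longrightarrow> (a, c) \<in> r"
    "\<And>a b. (a, b) \<in> r \<Longrightarrow> (b, a) \<in> r \<Longrightarrow> a = b"
    and s: "\<And>a b c. (a, b) \<in> s \<Longrightarrow> (b, c) \<in> s \<Longrightarrow> (a, c) \<in> s"
    "\<And>a b. (a, b) \<in> s \<Longrightarrow> (b, a) \<in> s \<Longrightarrow> a = b"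
    using assms unfolding fposet_iff trans_def antisym_def by blast+
  have "trans (disj_union r s)"
  proof (rule transI)
    fix x y z assume "(x, y) \<in> disj_union r s" "(y, z) \<in> disj_union r s"
    then show "(x, z) \<in> disj_union r s"
      by (cases x; cases y; cases z; simp; blast intro: r(1) s(1) FieldI1 FieldI2)
  qed
  moreover have "antisym (disj_union r s)"
  proof (rule antisymI)
    fix x y assume "(x, y) \<in> disj_union r s" "(y, x) \<in> disj_union r s"
    then show "x = y" by (cases x; cases y; simp; blast intro: r(2) s(2))
  qed
  ultimately show ?thesis using assms by (auto simp: fposet_iff)
qed

lemma fposet_ord_sum:
  assumes "fposet r" "fposet s" shows "fposet (ord_sum r s)"
proof -
  have r: "\<And>a b c. (a, b) \<in> r \<Longrightarrow> (b, c) \<in> r \<Longrightarrow> (a, c) \<in> r"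
    "\<And>a b. (a, b) \<in> r \<Longrightarrow> (b, a) \<in> r \<Longrightarrow> a = b"
    and s: "\<And>a b c. (a, b) \<in> s \<Longrightarrow> (b, c) \<in> s \<Longrightarrow> (a, c) \<in> s"
    "\<And>a b. (a, b) \<in> s \<Longrightarrow> (b, a) \<in> s \<Longrightarrow> a = b"
    using assms unfolding fposet_iff trans_def antisym_def by blast+
  have "trans (ord_sum r s)"
  proof (rule transI)
    fix x y z assume "(x, y) \<in> ord_sum r s" "(y, z) \<in> ord_sum r s"
    then show "(x, z) \<in> ord_sum r s"
      by (cases x; cases y; cases z; simp; blast intro: r(1) s(1) FieldI1 FieldI2)
  qed
  moreover have "antisym (ord_sum r s)"
  proof (rule antisymI)
    fix x y assume "(x, y) \<in> ord_sum r s" "(y, x) \<in> ord_sum r s"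
    then show "x = y" by (cases x; cases y; simp; blast intro: r(2) s(2))
  qed
  ultimately show ?thesis using assms by (auto simp: fposet_iff)
qed

lemma bij_betw_map_sum:
  assumes "bij_betw f A A'" "bij_betw g B B'"
  shows "bij_betw (map_sum f g) (A <+> B) (A' <+> B')"
proof -
  have "inj_on (map_sum f g) (A <+> B)"
  proof (rule inj_onI)
    fix x y assume "x \<in> A <+> B" "y \<in> A <+> B" "map_sum f g x = map_sum f g y"
    then show "x = y"
      using inj_onD[OF bij_betw_imp_inj_on[OF assms(1)]] inj_onD[OF bij_betw_imp_inj_on[OF assms(2)]]
      by (cases x; cases y; simp; blast)
  qed
  moreover have "map_sum f g ` (A <+> B) = f ` A <+> g ` B"
    unfolding Plus_def image_Un by (simp add: image_image)
  ultimately show ?thesis using assms by (simp add: bij_betw_def)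
qed

lemma poset_iso_disj_union:
  assumes "poset_iso r r'" "poset_iso s s'"
  shows "poset_iso (disj_union r s) (disj_union r' s')"
proof -
  obtain f where f: "is_iso r r' f" using assms(1) by (rule poset_isoE)
  obtain g where g: "is_iso s s' g" using assms(2) by (rule poset_isoE)
  have p: "fposet r" "fposet r'" "fposet s" "fposet s'" using assms by (auto elim: poset_isoE)
  have "is_iso (disj_union r s) (disj_union r' s') (map_sum f g)"
  proof (rule is_isoI)
    show "bij_betw (map_sum f g) (Field (disj_union r s)) (Field (disj_union r' s'))"
      using bij_betw_map_sum is_isoD(1)[OF f] is_isoD(1)[OF g] by simp
    fix x y assume "x \<in> Field (disj_union r s)" "y \<in> Field (disj_union r s)"
    then show "(map_sum f g x, map_sum f g y) \<in> disj_union r' s' \<longleftrightarrow> (x, y) \<in> disj_union r s"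
      using is_isoD(5)[OF f] is_isoD(5)[OF g] by (cases x; cases y) simp_all
  qed
  then show ?thesis using fposet_disj_union[OF p(1,3)] by (rule poset_isoI[rotated])
qed

lemma poset_iso_ord_sum:
  assumes "poset_iso r r'" "poset_iso s s'"
  shows "poset_iso (ord_sum r s) (ord_sum r' s')"
proof -
  obtain f where f: "is_iso r r' f" using assms(1) by (rule poset_isoE)
  obtain g where g: "is_iso s s' g" using assms(2) by (rule poset_isoE)
  have p: "fposet r" "fposet r'" "fposet s" "fposet s'" using assms by (auto elim: poset_isoE)
  have "is_iso (ord_sum r s) (ord_sum r' s') (map_sum f g)"
  proof (rule is_isoI)
    show "bij_betw (map_sum f g) (Field (ord_sum r s)) (Field (ord_sum r' s'))"
      using bij_betw_map_sum is_isoD(1)[OF f] is_isoD(1)[OF g] by simp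
    fix x y assume "x \<in> Field (ord_sum r s)" "y \<in> Field (ord_sum r s)"
    then show "(map_sum f g x, map_sum f g y) \<in> ord_sum r' s' \<longleftrightarrow> (x, y) \<in> ord_sum r s"
      using is_isoD(4,5)[OF f] is_isoD(4,5)[OF g] by (cases x; cases y) simp_all
  qed
  then show ?thesis using fposet_ord_sum[OF p(1,3)] by (rule poset_isoI[rotated])
qed

lemma star_orders_iff:
  "t \<in> star_orders r s \<longleftrightarrow> Field t = Field r <+> Field s \<and> Partial_order t \<and>
    (\<forall>a\<in>Field r. \<forall>b\<in>Field r. (Inl a, Inl b) \<in> t \<longleftrightarrow> (a, b) \<in> r) \<and>
    (\<forall>a\<in>Field s. \<forall>b\<in>Field s. (Inr a, Inr b) \<in> t \<longleftrightarrow> (a, b) \<in> s) \<and>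
    (\<forall>a\<in>Field r. \<forall>b\<in>Field s. (Inr b, Inl a) \<notin> t)"
proof -
  have 1: "partial_order_on (Field r <+> Field s) t \<longleftrightarrow>
    Field t = Field r <+> Field s \<and> Partial_order t"
  proof
    assume a: "partial_order_on (Field r <+> Field s) t"
    then have "t \<subseteq> (Field r <+> Field s) \<times> (Field r <+> Field s)"
      and "\<And>x. x \<in> Field r <+> Field s \<Longrightarrow> (x, x) \<in> t"
      unfolding order_on_defs refl_on_def by blast+
    then have "Field t = Field r <+> Field s"
      unfolding Field_def by blast
    then show "Field t = Field r <+> Field s \<and> Partial_order t" using a by simp
  qed auto
  have 2: "Restr t (Inl ` Field r) = map_prod Inl Inl ` r \<longleftrightarrow>
    (\<forall>a\<in>Field r. \<forall>b\<in>Field r. (Inl a, Inl b) \<in> t \<longleftrightarrow> (a, b) \<in> r)" (is "?L \<longleftrightarrow> ?R")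
  proof
    assume L: ?L
    show ?R
    proof (intro ballI)
      fix a b assume "a \<in> Field r" "b \<in> Field r"
      then have "(Inl a, Inl b) \<in> t \<longleftrightarrow> (Inl a, Inl b) \<in> Restr t (Inl ` Field r)" by blast
      then show "(Inl a, Inl b) \<in> t \<longleftrightarrow> (a, b) \<in> r" unfolding L by auto
    qed
  next
    assume R: ?R
    have "r \<subseteq> Field r \<times> Field r" by (auto intro: FieldI1 FieldI2)
    then show ?L using R by (fastforce simp: image_iff)
  qed
  have 3: "Restr t (Inr ` Field s) = map_prod Inr Inr ` s \<longleftrightarrow>
    (\<forall>a\<in>Field s. \<forall>b\<in>Field s. (Inr a, Inr b) \<in> t \<longleftrightarrow> (a, b) \<in> s)" (is "?L \<longleftrightarrow> ?R")
  proof
    assume L: ?L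
    show ?R
    proof (intro ballI)
      fix a b assume "a \<in> Field s" "b \<in> Field s"
      then have "(Inr a, Inr b) \<in> t \<longleftrightarrow> (Inr a, Inr b) \<in> Restr t (Inr ` Field s)" by blast
      then show "(Inr a, Inr b) \<in> t \<longleftrightarrow> (a, b) \<in> s" unfolding L by auto
    qed
  next
    assume R: ?R
    have "s \<subseteq> Field s \<times> Field s" by (auto intro: FieldI1 FieldI2)
    then show ?L using R by (fastforce simp: image_iff)
  qed
  have 4: "before t (Inl ` Field r) (Inr ` Field s) \<longleftrightarrow>
    (\<forall>a\<in>Field r. \<forall>b\<in>Field s. (Inr b, Inl a) \<notin> t)"
    unfolding before_def by blast
  show ?thesis unfolding star_orders_def mem_Collect_eq 1 2 3 4 by blast
qed

lemma fposet_star_orders: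
  assumes "t \<in> star_orders r s" "fposet r" "fposet s" shows "fposet t"
proof -
  have "Partial_order t" "Field t = Field r <+> Field s"
    using assms(1) unfolding star_orders_iff by blast+
  then show ?thesis using assms(2,3) unfolding fposet_def by (metis finite_Plus)
qed

lemma star_orders_map:
  assumes f: "is_iso r r' f" and g: "is_iso s s' g" and t: "t \<in> star_orders r s"
    and fin: "fposet r" "fposet s"
  shows "is_iso t (map_prod (map_sum f g) (map_sum f g) ` t) (map_sum f g)"
    "map_prod (map_sum f g) (map_sum f g) ` t \<in> star_orders r' s'"
proof -
  let ?h = "map_sum f g"
  define t' where "t' = map_prod ?h ?h ` t"
  note f = is_isoD[OF f] and g = is_isoD[OF g]
  note T = t[unfolded star_orders_iff]
  have Ft: "Field t = Field r <+> Field s" using T by blast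
  have h: "bij_betw ?h (Field t) (Field r' <+> Field s')"
    unfolding Ft using f(1) g(1) by (rule bij_betw_map_sum)
  show i: "is_iso t (map_prod (map_sum f g) (map_sum f g) ` t) ?h"
    using h by (simp add: is_iso_iff bij_betw_def)
  then have i: "is_iso t t' ?h" by (simp add: t'_def)
  have Ft': "Field t' = Field r' <+> Field s'"
    using is_isoD(3)[OF i] h by (simp add: bij_betw_def)
  have "fposet t'" using fposet_star_orders[OF t fin] i by (rule fposet_is_iso)
  then have po: "Partial_order t'" by (simp add: fposet_def)
  have o: "(?h x, ?h y) \<in> t' \<longleftrightarrow> (x, y) \<in> t"
    if "x \<in> Field r <+> Field s" "y \<in> Field r <+> Field s" for x y
    using is_isoD(5)[OF i] that Ft by blast
  have t1: "(Inl (f a), Inl (f b)) \<in> t' \<longleftrightarrow> (a, b) \<in> r" if "a \<in> Field r" "b \<in> Field r" for a b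
    using o[of "Inl a" "Inl b"] that T by simp
  have t2: "(Inr (g a), Inr (g b)) \<in> t' \<longleftrightarrow> (a, b) \<in> s" if "a \<in> Field s" "b \<in> Field s" for a b
    using o[of "Inr a" "Inr b"] that T by simp
  have t3: "(Inr (g b), Inl (f a)) \<notin> t'" if "a \<in> Field r" "b \<in> Field s" for a b
    using o[of "Inr b" "Inl a"] that T by simp
  have 1: "\<forall>a\<in>Field r'. \<forall>b\<in>Field r'. (Inl a, Inl b) \<in> t' \<longleftrightarrow> (a, b) \<in> r'"
    unfolding f(3)[symmetric] using t1 f(5) by simp
  have 2: "\<forall>a\<in>Field s'. \<forall>b\<in>Field s'. (Inr a, Inr b) \<in> t' \<longleftrightarrow> (a, b) \<in> s'"
    unfolding g(3)[symmetric] using t2 g(5) by simp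
  have 3: "\<forall>a\<in>Field r'. \<forall>b\<in>Field s'. (Inr b, Inl a) \<notin> t'"
    unfolding f(3)[symmetric] g(3)[symmetric] using t3 by simp
  show "map_prod ?h ?h ` t \<in> star_orders r' s'"
    unfolding t'_def[symmetric] star_orders_iff using Ft' po 1 2 3 by blast
qed

lemma map_prod_inverse:
  assumes "\<And>x. x \<in> Field t \<Longrightarrow> k (h x) = x"
  shows "map_prod k k ` map_prod h h ` t = t"
proof -
  have "map_prod k k (map_prod h h z) = z" if "z \<in> t" for z
  proof (cases z)
    case (Pair x y)
    then have "x \<in> Field t" "y \<in> Field t" using that by (auto intro: FieldI1 FieldI2)
    then show ?thesis using assms Pair by simp
  qed
  then show ?thesis by (simp add: image_image)
qed

lemma star_sum_cong:
  assumes "poset_iso r r'" "poset_iso s s'"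
  shows "(\<Sum>t\<in>star_orders r s. F (iso_class t)) = (\<Sum>t\<in>star_orders r' s'. F (iso_class t))"
proof -
  obtain f where f: "is_iso r r' f" using assms(1) by (rule poset_isoE)
  obtain g where g: "is_iso s s' g" using assms(2) by (rule poset_isoE)
  have p: "fposet r" "fposet r'" "fposet s" "fposet s'" using assms by (auto elim: poset_isoE)
  obtain f' where f': "is_iso r' r f'" "\<And>x. x \<in> Field r \<Longrightarrow> f' (f x) = x"
    "\<And>y. y \<in> Field r' \<Longrightarrow> f (f' y) = y"
    by (rule is_iso_inverse[OF f]) (blast intro: that)
  obtain g' where g': "is_iso s' s g'" "\<And>x. x \<in> Field s \<Longrightarrow> g' (g x) = x"
    "\<And>y. y \<in> Field s' \<Longrightarrow> g (g' y) = y"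
    by (rule is_iso_inverse[OF g]) (blast intro: that)
  let ?h = "map_sum f g" and ?k = "map_sum f' g'"
  show ?thesis
  proof (rule sum.reindex_bij_witness[of _ "(`) (map_prod ?k ?k)" "(`) (map_prod ?h ?h)"])
    fix t assume t: "t \<in> star_orders r s"
    note m = star_orders_map[OF f g t p(1,3)]
    have F: "Field t = Field r <+> Field s" using t by (simp add: star_orders_iff)
    show "map_prod ?h ?h ` t \<in> star_orders r' s'" by (rule m(2))
    show "map_prod ?k ?k ` map_prod ?h ?h ` t = t"
      by (rule map_prod_inverse) (use f'(2) g'(2) F in auto)
    have "poset_iso t (map_prod ?h ?h ` t)"
      using fposet_star_orders[OF t p(1,3)] m(1) by (rule poset_isoI)
    then show "F (iso_class (map_prod ?h ?h ` t)) = F (iso_class t)"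
      by (simp add: iso_class_eqI)
  next
    fix t assume t: "t \<in> star_orders r' s'"
    have F: "Field t = Field r' <+> Field s'" using t by (simp add: star_orders_iff)
    show "map_prod ?k ?k ` t \<in> star_orders r s"
      by (rule star_orders_map(2)[OF f'(1) g'(1) t p(2,4)])
    show "map_prod ?h ?h ` map_prod ?k ?k ` t = t"
      by (rule map_prod_inverse) (use f'(3) g'(3) F in auto)
  qed
qed

lemma poset_iso_Restr:
  assumes "fposet r" "is_iso r r' f" "I \<subseteq> Field r"
  shows "poset_iso (Restr r I) (Restr r' (f ` I))"
proof -
  note f = is_isoD[OF assms(2)]
  have rf: "(x, x) \<in> r" if "x \<in> I" for x using assms(1,3) that unfolding fposet_iff by blast
  have F: "Field (Restr r I) = I" unfolding Field_def using rf by blast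
  have "trans r" "antisym r" "finite I"
    using assms(1,3) unfolding fposet_iff by (blast intro: finite_subset)+
  then have p: "fposet (Restr r I)"
    unfolding fposet_iff F using rf trans_Restr antisym_subset[of "Restr r I" r] by blast
  have "bij_betw f I (f ` I)" using f(2) assms(3) by (meson inj_on_imp_bij_betw inj_on_subset)
  moreover have "Field (Restr r' (f ` I)) = f ` I"
  proof -
    have "(f x, f x) \<in> r'" if "x \<in> I" for x using f(5) rf assms(3) that by blast
    then show ?thesis unfolding Field_def by blast
  qed
  ultimately have "is_iso (Restr r I) (Restr r' (f ` I)) f"
  proof (intro is_isoI)
    fix x y assume "x \<in> Field (Restr r I)" "y \<in> Field (Restr r I)"
    then have I: "x \<in> I" "y \<in> I" unfolding F .
    then have "(f x, f y) \<in> r' \<longleftrightarrow> (x, y) \<in> r" using f(5) assms(3) by blast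
    then show "(f x, f y) \<in> Restr r' (f ` I) \<longleftrightarrow> (x, y) \<in> Restr r I" using I by blast
  qed (simp add: F)
  then show ?thesis by (rule poset_isoI[OF p])
qed

lemma before_map:
  assumes "is_iso r r' f" "I \<subseteq> Field r" "J \<subseteq> Field r"
  shows "before r' (f ` J) (f ` I) \<longleftrightarrow> before r J I"
proof -
  have "(f y, f x) \<in> r' \<longleftrightarrow> (y, x) \<in> r" if "x \<in> J" "y \<in> I" for x y
    using is_isoD(5)[OF assms(1)] assms(2,3) that by blast
  then show ?thesis unfolding before_def by simp
qed

lemma image_inverse:
  assumes "\<And>x. x \<in> A \<Longrightarrow> g (f x) = x" "I \<subseteq> A"
  shows "g ` f ` I = I"
proof -
  have "(\<lambda>x. g (f x)) ` I = (\<lambda>x. x) ` I" using assms by (intro image_cong) auto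
  then show ?thesis by (simp add: image_image)
qed

lemma coprod_star_of_cong:
  assumes "poset_iso r r'" shows "coprod_star_of r = coprod_star_of r'"
proof -
  obtain f where f: "is_iso r r' f" and p: "fposet r" "fposet r'"
    using assms by (rule poset_isoE)
  obtain f' where f': "is_iso r' r f'" "\<And>x. x \<in> Field r \<Longrightarrow> f' (f x) = x"
    "\<And>y. y \<in> Field r' \<Longrightarrow> f (f' y) = y"
    by (rule is_iso_inverse[OF f]) (blast intro: that)
  have im: "f ` (Field r - I) = Field r' - f ` I" if "I \<subseteq> Field r" for I
    using inj_on_image_set_diff[OF is_isoD(2)[OF f] _ that, of "Field r"] is_isoD(3)[OF f] by simp
  have im': "f' ` (Field r' - I) = Field r - f' ` I" if "I \<subseteq> Field r'" for I
    using inj_on_image_set_diff[OF is_isoD(2)[OF f'(1)] _ that, of "Field r'"] is_isoD(3)[OF f'(1)]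
    by simp
  show ?thesis
    unfolding coprod_star_of_def
  proof (rule sum.reindex_bij_witness[of _ "(`) f'" "(`) f"])
    fix I assume "I \<in> {I. I \<subseteq> Field r \<and> before r (Field r - I) I}"
    then have I: "I \<subseteq> Field r" "before r (Field r - I) I" by simp_all
    show "f' ` f ` I = I" using f'(2) I(1) by (rule image_inverse)
    have "f ` I \<subseteq> Field r'" using I(1) is_isoD(3)[OF f] by blast
    then show "f ` I \<in> {I. I \<subseteq> Field r' \<and> before r' (Field r' - I) I}"
      using I(2) before_map[OF f I(1), of "Field r - I"] im[OF I(1)] by simp
    show "basis (iso_class (Restr r' (Field r' - f ` I)), iso_class (Restr r' (f ` I))) =
      basis (iso_class (Restr r (Field r - I)), iso_class (Restr r I))"
      using iso_class_eqI[OF poset_iso_Restr[OF p(1) f I(1)]]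
        iso_class_eqI[OF poset_iso_Restr[OF p(1) f, of "Field r - I"]] im[OF I(1)] by simp
  next
    fix I assume "I \<in> {I. I \<subseteq> Field r' \<and> before r' (Field r' - I) I}"
    then have I: "I \<subseteq> Field r'" "before r' (Field r' - I) I" by simp_all
    show "f ` f' ` I = I" using f'(3) I(1) by (rule image_inverse)
    have "f' ` I \<subseteq> Field r" using I(1) is_isoD(3)[OF f'(1)] by blast
    then show "f' ` I \<in> {I. I \<subseteq> Field r \<and> before r (Field r - I) I}"
      using I(2) before_map[OF f'(1) I(1), of "Field r' - I"] im'[OF I(1)] by simp
  qed
qed

lemma hasse_map:
  assumes "is_iso r r' f" "(x, y) \<in> hasse r" shows "(f x, f y) \<in> hasse r'"
proof -
  note f = is_isoD[OF assms(1)]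
  have xy: "(x, y) \<in> r" "x \<noteq> y" "\<And>z. (x, z) \<in> r \<Longrightarrow> (z, y) \<in> r \<Longrightarrow> z = x \<or> z = y"
    using assms(2) unfolding hasse_def by blast+
  have F: "x \<in> Field r" "y \<in> Field r" using xy(1) by (auto intro: FieldI1 FieldI2)
  have "w = f x \<or> w = f y" if w: "(f x, w) \<in> r'" "(w, f y) \<in> r'" for w
  proof -
    have "w \<in> Field r'" using w(1) by (rule FieldI2)
    then obtain z where z: "z \<in> Field r" "w = f z" using f(3) by blast
    then have "(x, z) \<in> r" "(z, y) \<in> r" using w f(5) F by blast+
    then show ?thesis using xy(3) z by blast
  qed
  moreover have "(f x, f y) \<in> r'" using xy(1) F f(5) by blast
  moreover have "f x \<noteq> f y" using xy(2) F f(2) by (meson inj_onD)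
  ultimately show ?thesis unfolding hasse_def by blast
qed

lemma conn_map:
  assumes "is_iso r r' f" "(x, y) \<in> (hasse r \<union> (hasse r)\<inverse>)\<^sup>*"
  shows "(f x, f y) \<in> (hasse r' \<union> (hasse r')\<inverse>)\<^sup>*"
  using assms(2)
proof (induction rule: rtrancl_induct)
  case (step y z)
  then have "(f y, f z) \<in> hasse r' \<union> (hasse r')\<inverse>" using hasse_map[OF assms(1)] by blast
  then show ?case using step.IH by (rule rtrancl_into_rtrancl[rotated])
qed simp

lemma components_iff:
  "C \<in> components r \<longleftrightarrow>
    (\<exists>x\<in>Field r. C = {y \<in> Field r. (x, y) \<in> (hasse r \<union> (hasse r)\<inverse>)\<^sup>*})"
proof -
  have "Restr ((hasse r \<union> (hasse r)\<inverse>)\<^sup>*) (Field r) `` {x} =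
    {y \<in> Field r. (x, y) \<in> (hasse r \<union> (hasse r)\<inverse>)\<^sup>*}" if "x \<in> Field r" for x
    using that by blast
  then show ?thesis unfolding components_def quotient_def by auto
qed

lemma components_subset: "C \<in> components r \<Longrightarrow> C \<subseteq> Field r"
  unfolding components_iff by blast

lemma components_map:
  assumes f: "is_iso r r' f" and C: "C \<in> components r"
  shows "f ` C \<in> components r'"
proof -
  obtain f' where f': "is_iso r' r f'" "\<And>x. x \<in> Field r \<Longrightarrow> f' (f x) = x"
    "\<And>y. y \<in> Field r' \<Longrightarrow> f (f' y) = y"
    by (rule is_iso_inverse[OF f]) (blast intro: that)
  obtain x where x: "x \<in> Field r" "C = {y \<in> Field r. (x, y) \<in> (hasse r \<union> (hasse r)\<inverse>)\<^sup>*}"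
    using C unfolding components_iff by blast
  have "f ` C = {y \<in> Field r'. (f x, y) \<in> (hasse r' \<union> (hasse r')\<inverse>)\<^sup>*}"
  proof (intro set_eqI iffI)
    fix w assume "w \<in> f ` C"
    then obtain y where y: "w = f y" "y \<in> Field r" "(x, y) \<in> (hasse r \<union> (hasse r)\<inverse>)\<^sup>*"
      using x(2) by blast
    then show "w \<in> {y \<in> Field r'. (f x, y) \<in> (hasse r' \<union> (hasse r')\<inverse>)\<^sup>*}"
      using conn_map[OF f y(3)] is_isoD(4)[OF f y(2)] by simp
  next
    fix w assume "w \<in> {y \<in> Field r'. (f x, y) \<in> (hasse r' \<union> (hasse r')\<inverse>)\<^sup>*}"
    then have w: "w \<in> Field r'" "(f x, w) \<in> (hasse r' \<union> (hasse r')\<inverse>)\<^sup>*" by simp_all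
    have "f' w \<in> C"
      using conn_map[OF f'(1) w(2)] is_isoD(4)[OF f'(1) w(1)] f'(2)[OF x(1)] x(2) by simp
    then have "f (f' w) \<in> f ` C" by (rule imageI)
    then show "w \<in> f ` C" using f'(3)[OF w(1)] by simp
  qed
  then show ?thesis using is_isoD(4)[OF f x(1)] unfolding components_iff by blast
qed

lemma in_rtrancl_hasse:
  assumes "fposet r" "(x, y) \<in> r" shows "(x, y) \<in> (hasse r)\<^sup>*"
  using assms(2)
proof (induction "card {z. (x, z) \<in> r \<and> (z, y) \<in> r}" arbitrary: x y rule: less_induct)
  case less
  have r: "\<And>a b c. (a, b) \<in> r \<Longrightarrow> (b, c) \<in> r \<Longrightarrow> (a, c) \<in> r"
    "\<And>a b. (a, b) \<in> r \<Longrightarrow> (b, a) \<in> r \<Longrightarrow> a = b"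
    "finite (Field r)" "\<And>u. u \<in> Field r \<Longrightarrow> (u, u) \<in> r"
    using assms(1) unfolding fposet_iff trans_def antisym_def by blast+
  show ?case
  proof (cases "x = y \<or> (x, y) \<in> hasse r")
    case False
    then obtain z where z: "(x, z) \<in> r" "(z, y) \<in> r" "z \<noteq> x" "z \<noteq> y"
      using less.prems unfolding hasse_def by blast
    let ?B = "\<lambda>x y. {z. (x, z) \<in> r \<and> (z, y) \<in> r}"
    have "?B x y \<subseteq> Field r" by (auto intro: FieldI2)
    then have fin: "finite (?B x y)" using r(3) by (rule finite_subset)
    have "x \<in> ?B x y" "y \<in> ?B x y"
      using less.prems r(4)[OF FieldI1[OF less.prems]] r(4)[OF FieldI2[OF less.prems]] by simp_all
    moreover have "y \<notin> ?B x z" "x \<notin> ?B z y" using z r(2) by blast+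
    moreover have "?B x z \<subseteq> ?B x y" "?B z y \<subseteq> ?B x y" using z r(1) by blast+
    ultimately have "?B x z \<subset> ?B x y" "?B z y \<subset> ?B x y" by blast+
    then have "card (?B x z) < card (?B x y)" "card (?B z y) < card (?B x y)"
      using psubset_card_mono[OF fin] by blast+
    then have "(x, z) \<in> (hasse r)\<^sup>*" "(z, y) \<in> (hasse r)\<^sup>*" using less.hyps z(1,2) by blast+
    then show ?thesis by (rule rtrancl_trans)
  qed auto
qed

lemma UN_components_Restr:
  assumes "fposet r" "I \<subseteq> components r"
  shows "(\<Union>C\<in>I. Restr r C) = Restr r (\<Union>I)"
proof -
  have "y \<in> C" if C: "C \<in> I" "x \<in> C" and r: "(x, y) \<in> r" for x y C
  proof -
    have "(hasse r)\<^sup>* \<subseteq> (hasse r \<union> (hasse r)\<inverse>)\<^sup>*" by (rule rtrancl_mono) blast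
    then have xy: "(x, y) \<in> (hasse r \<union> (hasse r)\<inverse>)\<^sup>*"
      using in_rtrancl_hasse[OF assms(1) r] by blast
    obtain w where w: "C = {y \<in> Field r. (w, y) \<in> (hasse r \<union> (hasse r)\<inverse>)\<^sup>*}"
      using C(1) assms(2) components_iff[of C r] by blast
    then have "(w, x) \<in> (hasse r \<union> (hasse r)\<inverse>)\<^sup>*" using C(2) by simp
    then have "(w, y) \<in> (hasse r \<union> (hasse r)\<inverse>)\<^sup>*" using xy by (rule rtrancl_trans)
    then show ?thesis using w FieldI2[OF r] by simp
  qed
  then show ?thesis by blast
qed

lemma coprod_of_cong:
  assumes "poset_iso r r'" shows "coprod_of r = coprod_of r'"
proof -
  obtain f where f: "is_iso r r' f" and p: "fposet r" "fposet r'"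
    using assms by (rule poset_isoE)
  obtain f' where f': "is_iso r' r f'" "\<And>x. x \<in> Field r \<Longrightarrow> f' (f x) = x"
    "\<And>y. y \<in> Field r' \<Longrightarrow> f (f' y) = y"
    by (rule is_iso_inverse[OF f]) (blast intro: that)
  have inv: "f' ` f ` C = C" if "C \<in> components r" for C
    using f'(2) components_subset[OF that] by (rule image_inverse)
  have inv': "f ` f' ` C = C" if "C \<in> components r'" for C
    using f'(3) components_subset[OF that] by (rule image_inverse)
  have ii: "(`) f' ` (`) f ` I = I" if "I \<subseteq> components r" for I
    using inv that by (rule image_inverse)
  have ii': "(`) f ` (`) f' ` I = I" if "I \<subseteq> components r'" for I
    using inv' that by (rule image_inverse)
  have c: "(`) f ` I \<subseteq> components r'" if "I \<subseteq> components r" for I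
    using components_map[OF f] that by blast
  have c': "(`) f' ` I \<subseteq> components r" if "I \<subseteq> components r'" for I
    using components_map[OF f'(1)] that by blast
  have onto: "(`) f ` components r = components r'"
  proof
    show "components r' \<subseteq> (`) f ` components r"
      using image_mono[OF c'[of "components r'"], of "(`) f"] ii'[of "components r'"] by simp
  qed (rule c, rule order_refl)
  have inj: "inj_on ((`) f) (components r)" using inv by (rule inj_on_inverseI)
  have im: "(`) f ` (components r - I) = components r' - (`) f ` I" if "I \<subseteq> components r" for I
    using inj_on_image_set_diff[OF inj Diff_subset that] unfolding onto .
  have key: "iso_class (\<Union>C\<in>(`) f ` I. Restr r' C) = iso_class (\<Union>C\<in>I. Restr r C)"
    if I: "I \<subseteq> components r" for I
  proof -
    have "\<Union>I \<subseteq> Field r" using I components_subset by blast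
    then have "poset_iso (Restr r (\<Union>I)) (Restr r' (f ` \<Union>I))"
      by (rule poset_iso_Restr[OF p(1) f])
    then have "iso_class (Restr r (\<Union>I)) = iso_class (Restr r' (f ` \<Union>I))"
      by (rule iso_class_eqI)
    then show ?thesis
      unfolding UN_components_Restr[OF p(1) I] UN_components_Restr[OF p(2) c[OF I]] image_Union
      by (rule sym)
  qed
  show ?thesis
    unfolding coprod_of_def
  proof (rule sum.reindex_bij_witness[of _ "(`) ((`) f')" "(`) ((`) f)"])
    fix I assume "I \<in> Pow (components r)"
    then have I: "I \<subseteq> components r" by (rule PowD)
    show "(`) f' ` (`) f ` I = I" using ii[OF I] .
    show "(`) f ` I \<in> Pow (components r')" using c[OF I] by (rule PowI)
    have "components r - I \<subseteq> components r" by blast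
    from key[OF this] key[OF I]
    show "basis (iso_class (\<Union>C\<in>(`) f ` I. Restr r' C),
        iso_class (\<Union>C\<in>components r' - (`) f ` I. Restr r' C)) =
      basis (iso_class (\<Union>C\<in>I. Restr r C), iso_class (\<Union>C\<in>components r - I. Restr r C))"
      unfolding im[OF I] by (rule arg_cong[where f = basis, OF arg_cong2[where f = Pair], rotated])
  next
    fix I assume "I \<in> Pow (components r')"
    then have I: "I \<subseteq> components r'" by (rule PowD)
    show "(`) f ` (`) f' ` I = I" using ii'[OF I] .
    show "(`) f' ` I \<in> Pow (components r)" using c'[OF I] by (rule PowI)
  qed
qed

lemma is_iso_comp:
  assumes "is_iso r s f" "is_iso s t g" shows "is_iso r t (\<lambda>x. g (f x))"
proof (rule is_isoI)
  show "bij_betw (\<lambda>x. g (f x)) (Field r) (Field t)"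
    using bij_betw_trans[OF is_isoD(1)[OF assms(1)] is_isoD(1)[OF assms(2)]] by (simp add: o_def)
  fix x y assume "x \<in> Field r" "y \<in> Field r"
  then show "(g (f x), g (f y)) \<in> t \<longleftrightarrow> (x, y) \<in> r"
    using is_isoD(4,5)[OF assms(1)] is_isoD(5)[OF assms(2)] by blast
qed

lemma is_iso_restrict: "is_iso r s (restrict f (Field r)) \<longleftrightarrow> is_iso r s f"
  unfolding is_iso_def using bij_betw_cong[of "Field r" "restrict f (Field r)" f] by simp

lemma num_aut_cong:
  assumes "poset_iso r r'" shows "num_aut r = num_aut r'"
proof -
  obtain f where f: "is_iso r r' f" using assms by (rule poset_isoE)
  obtain g where g: "is_iso r' r g" "\<And>x. x \<in> Field r \<Longrightarrow> g (f x) = x"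
    "\<And>y. y \<in> Field r' \<Longrightarrow> f (g y) = y"
    by (rule is_iso_inverse[OF f]) (blast intro: that)
  define A where "A = {f \<in> extensional (Field r). is_iso r r f}"
  define A' where "A' = {f \<in> extensional (Field r'). is_iso r' r' f}"
  define F where "F = (\<lambda>h. restrict (\<lambda>y. f (h (g y))) (Field r'))"
  define G where "G = (\<lambda>h. restrict (\<lambda>x. g (h (f x))) (Field r))"
  have 1: "F h \<in> A'" if "h \<in> A" for h
    using is_iso_comp[OF is_iso_comp[OF g(1)] f, of h] that
    unfolding A_def A'_def F_def by (simp add: is_iso_restrict)
  have 2: "G h \<in> A" if "h \<in> A'" for h
    using is_iso_comp[OF is_iso_comp[OF f] g(1), of h] that
    unfolding A_def A'_def G_def by (simp add: is_iso_restrict)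
  have 3: "G (F h) = h" if "h \<in> A" for h
  proof (rule extensionalityI[of _ "Field r"])
    have h: "is_iso r r h" "h \<in> extensional (Field r)" using that unfolding A_def by simp_all
    show "G (F h) \<in> extensional (Field r)" "h \<in> extensional (Field r)"
      unfolding G_def using h(2) by simp_all
    fix x assume x: "x \<in> Field r"
    show "G (F h) x = h x"
      unfolding G_def F_def using x is_isoD(4)[OF f x] is_isoD(4)[OF h(1) x] g(2) by simp
  qed
  have 4: "F (G h) = h" if "h \<in> A'" for h
  proof (rule extensionalityI[of _ "Field r'"])
    have h: "is_iso r' r' h" "h \<in> extensional (Field r')" using that unfolding A'_def by simp_all
    show "F (G h) \<in> extensional (Field r')" "h \<in> extensional (Field r')"
      unfolding F_def using h(2) by simp_all
    fix x assume x: "x \<in> Field r'"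
    show "F (G h) x = h x"
      unfolding G_def F_def using x is_isoD(4)[OF g(1) x] is_isoD(4)[OF h(1) x] g(3) by simp
  qed
  have "bij_betw F A A'"
    by (rule bij_betw_byWitness[where f' = G]) (use 1 2 3 4 in blast)+
  then show ?thesis unfolding num_aut_def A_def A'_def by (rule bij_betw_same_card)
qed

theorem prod_m_iso_class:
  assumes "fposet r" "fposet s"
  shows "prod_m (basis (iso_class r)) (basis (iso_class s)) = basis (iso_class (disj_union r s))"
  using iso_class_eqI[OF poset_iso_disj_union[OF assms[THEN poset_iso_rep_iso_class]]]
  by (simp add: prod_m_def)

theorem prod_down_iso_class:
  assumes "fposet r" "fposet s"
  shows "prod_down (basis (iso_class r)) (basis (iso_class s)) = basis (iso_class (ord_sum r s))"
  using iso_class_eqI[OF poset_iso_ord_sum[OF assms[THEN poset_iso_rep_iso_class]]]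
  by (simp add: prod_down_def)

theorem prod_star_iso_class:
  assumes "fposet r" "fposet s"
  shows "prod_star (basis (iso_class r)) (basis (iso_class s)) =
    (\<Sum>t\<in>star_orders r s. basis (iso_class t))"
  unfolding prod_star_def bilin_ext_basis
  by (rule star_sum_cong[OF assms[THEN poset_iso_rep_iso_class]])

theorem coprod_iso_class: "fposet r \<Longrightarrow> coprod (basis (iso_class r)) = coprod_of r"
  unfolding coprod_def lin_ext_basis by (rule coprod_of_cong[OF poset_iso_rep_iso_class])

theorem coprod_star_iso_class:
  "fposet r \<Longrightarrow> coprod_star (basis (iso_class r)) = coprod_star_of r"
  unfolding coprod_star_def lin_ext_basis by (rule coprod_star_of_cong[OF poset_iso_rep_iso_class])

theorem pairing_iso_class:
  assumes "fposet r" "fposet s"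
  shows "pairing (basis (iso_class r)) (basis (iso_class s)) =
    (if poset_iso r s then of_nat (num_aut r) else 0)"
  using iso_class_eq_iff[OF assms] num_aut_cong[OF poset_iso_rep_iso_class[OF assms(1)]]
  by (simp add: pairing_def)

theorem counit_iso_class:
  assumes "fposet r"
  shows "counit (basis (iso_class r)) = (if r = {} then 1 else 0)"
proof -
  have "poset_iso r ({} :: nat rel) \<longleftrightarrow> r = {}"
    using assms by (cases "r = {}") (simp_all add: poset_iso_iff)
  then show ?thesis
    using iso_class_eq_iff[OF assms fposet_empty[where 'a = nat]] by (simp add: counit_def)
qed

end

theory Submission
  imports Defs
begin

text \<open>
  The pairing is diagonal in the basis of isoclasses, with weights the numbers of automorphisms; in
  characteristic zero it is non-degenerate. Hence all the axioms for \<open>*\<close> and \<open>\<Delta>\<close> follow by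
  transposition from those for \<open>m\<close> and \<open>\<Delta>\<^sub>*\<close>, once the products and coproducts are known to be
  adjoint. The axioms for \<open>m\<close>, \<open>\<down>\<close> and \<open>\<Delta>\<^sub>*\<close> hold by inspection of upper sets: those of a disjoint
  union are the disjoint unions of upper sets, and those of \<open>A \<down> B\<close> are the \<open>I \<union> B\<close> and the \<open>J \<subseteq> B\<close>, where \<open>B\<close>
  itself is counted twice, whence the correction term \<open>- x \<otimes> y\<close>.

  Adjointness is a count of isomorphisms, since \<open>\<langle>A, C\<rangle>\<close> is the number of isomorphisms from \<open>A\<close> to
  \<open>C\<close>. Both sides of \<open>\<langle>A * B, C\<rangle> = \<langle>A \<otimes> B, \<Delta>\<^sub>* C\<rangle>\<close> count the bijections from \<open>A \<squnion> B\<close> to \<open>C\<close> that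
  are order embeddings on \<open>A\<close> and on \<open>B\<close> and map \<open>B\<close> to an upper set: the order on \<open>A \<squnion> B\<close> is
  pulled back from \<open>C\<close>. For \<open>m\<close> and \<open>\<Delta>\<close> the image of \<open>A\<close> has to be a union of components.
\<close>

section \<open>Linear maps on spaces with a basis\<close>

abbreviation lin :: "(('a \<Rightarrow>\<^sub>0 'k) \<Rightarrow> ('b \<Rightarrow>\<^sub>0 'k::field)) \<Rightarrow> bool" where
  "lin \<equiv> Vector_Spaces.linear scl scl"

abbreviation linf :: "(('a \<Rightarrow>\<^sub>0 'k) \<Rightarrow> 'k::field) \<Rightarrow> bool" where
  "linf \<equiv> Vector_Spaces.linear scl (*)"

lemma vector_space_mult: "vector_space ((*) :: 'k::field \<Rightarrow> 'k \<Rightarrow> 'k)"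
  by unfold_locales (auto simp: algebra_simps)

lemma lin_iff: "lin F \<longleftrightarrow> (\<forall>x y. F (x + y) = F x + F y) \<and> (\<forall>c x. F (scl c x) = scl c (F x))"
  by (simp add: Vector_Spaces.linear_iff vector_space_scl)

lemma linf_iff: "linf F \<longleftrightarrow> (\<forall>x y. F (x + y) = F x + F y) \<and> (\<forall>c x. F (scl c x) = c * F x)"
  by (simp add: Vector_Spaces.linear_iff vector_space_scl vector_space_mult)

lemma lin_ident: "lin (\<lambda>x. x)"
  by (simp add: lin_iff)

lemma lin_id: "lin id"
  by (simp add: lin_iff)

section \<open>Linearity of the linear extensions\<close>

lemma scl_simps:
  "scl c (x + y) = scl c x + scl c y" "scl (c + d) x = scl c x + scl d x"
  "scl c (scl d x) = scl (c * d) x" "scl 0 x = 0" "scl 1 x = x" "scl c 0 = 0"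
  by (auto intro!: poly_mapping_eqI simp: lookup_add algebra_simps)

text \<open>Indices outside the support contribute zero. Any finite superset of the support may
  therefore serve as index set, which lets \<open>x\<close>, \<open>y\<close> and
  \<open>x + y\<close> be summed over a common one.\<close>

lemma lin_ext_eq_sum:
  assumes "finite A" "Poly_Mapping.keys x \<subseteq> A"
  shows "lin_ext f x = (\<Sum>a\<in>A. scl (Poly_Mapping.lookup x a) (f a))"
  unfolding lin_ext_def
  using assms by (intro sum.mono_neutral_left) (auto simp: in_keys_iff scl_simps)

lemma lin_form_eq_sum:
  assumes "finite A" "Poly_Mapping.keys x \<subseteq> A"
  shows "lin_form f x = (\<Sum>a\<in>A. Poly_Mapping.lookup x a * f a)"
  unfolding lin_form_def
  using assms by (intro sum.mono_neutral_left) (auto simp: in_keys_iff)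

lemma scl_sum: "scl c (sum f A) = (\<Sum>a\<in>A. scl c (f a))"
  by (induction A rule: infinite_finite_induct) (auto simp: scl_simps)

lemma keys_scl_subset: "Poly_Mapping.keys (scl c x) \<subseteq> Poly_Mapping.keys x"
  by (auto simp: in_keys_iff)

lemma lin_lin_ext:
  fixes f :: "'a \<Rightarrow> ('b \<Rightarrow>\<^sub>0 'k::field)"
  shows "lin (lin_ext f)"
  unfolding lin_iff
proof (intro conjI allI)
  fix x y :: "'a \<Rightarrow>\<^sub>0 'k"
  let ?A = "Poly_Mapping.keys x \<union> Poly_Mapping.keys y"
  have k: "finite ?A" "Poly_Mapping.keys (x + y) \<subseteq> ?A" by (simp_all add: Poly_Mapping.keys_add)
  show "lin_ext f (x + y) = lin_ext f x + lin_ext f y"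
    using lin_ext_eq_sum[OF k, of f] lin_ext_eq_sum[of ?A x f] lin_ext_eq_sum[of ?A y f]
    by (simp add: lookup_add scl_simps sum.distrib)
next
  fix c x
  show "lin_ext f (scl c x) = scl c (lin_ext f x)"
    unfolding lin_ext_eq_sum[OF finite_keys keys_scl_subset] lin_ext_def[of f x]
    by (simp add: scl_sum scl_simps)
qed

lemma linf_lin_form:
  fixes f :: "'a \<Rightarrow> 'k::field"
  shows "linf (lin_form f)"
  unfolding linf_iff
proof (intro conjI allI)
  fix x y :: "'a \<Rightarrow>\<^sub>0 'k"
  let ?A = "Poly_Mapping.keys x \<union> Poly_Mapping.keys y"
  have k: "finite ?A" "Poly_Mapping.keys (x + y) \<subseteq> ?A" by (simp_all add: Poly_Mapping.keys_add)
  show "lin_form f (x + y) = lin_form f x + lin_form f y"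
    using lin_form_eq_sum[OF k, of f] lin_form_eq_sum[of ?A x f] lin_form_eq_sum[of ?A y f]
    by (simp add: lookup_add algebra_simps sum.distrib)
next
  fix c x
  show "lin_form f (scl c x) = c * lin_form f x"
    unfolding lin_form_eq_sum[OF finite_keys keys_scl_subset] lin_form_def[of f x]
    by (simp add: sum_distrib_left algebra_simps)
qed

section \<open>Closure properties of linear maps and determination on a basis\<close>

lemma lin_compose: "lin F \<Longrightarrow> lin G \<Longrightarrow> lin (\<lambda>x. G (F x))"
  by (simp add: lin_iff)

lemma linf_compose: "lin F \<Longrightarrow> linf G \<Longrightarrow> linf (\<lambda>x. G (F x))"
  by (simp add: lin_iff linf_iff)

lemma lin_sum: "(\<And>a. a \<in> A \<Longrightarrow> lin (F a)) \<Longrightarrow> lin (\<lambda>x. \<Sum>a\<in>A. F a x)"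
  by (simp add: lin_iff sum.distrib scl_sum)

lemma lin_add: "lin F \<Longrightarrow> lin G \<Longrightarrow> lin (\<lambda>x. F x + G x)"
  by (simp add: lin_iff scl_simps algebra_simps)

lemma lin_diff: "lin F \<Longrightarrow> lin G \<Longrightarrow> lin (\<lambda>x. F x - G x)"
  by (auto simp: lin_iff algebra_simps intro!: poly_mapping_eqI simp: lookup_minus lookup_add)

lemma lin_scl: "lin F \<Longrightarrow> lin (\<lambda>x. scl c (F x))"
  by (simp add: lin_iff scl_simps mult.commute)

lemma linf_cmult: "linf F \<Longrightarrow> linf (\<lambda>x. c * F x)"
  by (simp add: linf_iff algebra_simps)

lemma linf_multc: "linf F \<Longrightarrow> linf (\<lambda>x. F x * c)"
  by (simp add: linf_iff algebra_simps)

lemma linf_sum: "(\<And>a. a \<in> A \<Longrightarrow> linf (F a)) \<Longrightarrow> linf (\<lambda>x. \<Sum>a\<in>A. F a x)"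
  by (simp add: linf_iff sum.distrib sum_distrib_left)

lemma lin_zero: "lin F \<Longrightarrow> F 0 = 0"
  unfolding lin_iff by (metis scl_simps(4))

lemma linf_zero: "linf F \<Longrightarrow> F 0 = 0"
  unfolding linf_iff by (metis scl_simps(4) mult_zero_left)

lemma lin_of_sum: "lin F \<Longrightarrow> F (sum g A) = (\<Sum>a\<in>A. F (g a))"
  by (induction A rule: infinite_finite_induct) (auto simp: lin_zero, simp add: lin_iff)

lemma linf_of_sum: "linf F \<Longrightarrow> F (sum g A) = (\<Sum>a\<in>A. F (g a))"
  by (induction A rule: infinite_finite_induct) (auto simp: linf_zero, simp add: linf_iff)

lemma sum_scl_basis: "(\<Sum>a\<in>Poly_Mapping.keys x. scl (Poly_Mapping.lookup x a) (basis a)) = x"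
  by (rule poly_mapping_eqI)
    (simp add: Poly_Mapping.lookup_sum lookup_basis if_distrib in_keys_iff cong: if_cong)

text \<open>Every vector is a finite combination of basis elements. Multilinear identities are
  reduced to basis elements by applying this to one argument at a time.\<close>

lemma lin_eq_on_basis:
  assumes "lin F" "lin G" "\<And>a. F (basis a) = G (basis a)" shows "F x = G x"
proof -
  have "F (\<Sum>a\<in>Poly_Mapping.keys x. scl (Poly_Mapping.lookup x a) (basis a)) =
    G (\<Sum>a\<in>Poly_Mapping.keys x. scl (Poly_Mapping.lookup x a) (basis a))"
    unfolding lin_of_sum[OF assms(1)] lin_of_sum[OF assms(2)] using assms by (simp add: lin_iff)
  then show ?thesis by (simp add: sum_scl_basis)
qed

lemma linf_eq_on_basis:
  assumes "linf F" "linf G" "\<And>a. F (basis a) = G (basis a)" shows "F x = G x"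
proof -
  have "F (\<Sum>a\<in>Poly_Mapping.keys x. scl (Poly_Mapping.lookup x a) (basis a)) =
    G (\<Sum>a\<in>Poly_Mapping.keys x. scl (Poly_Mapping.lookup x a) (basis a))"
    unfolding linf_of_sum[OF assms(1)] linf_of_sum[OF assms(2)] using assms by (simp add: linf_iff)
  then show ?thesis by (simp add: sum_scl_basis)
qed

section \<open>Linearity of the tensor constructions\<close>

lemma lin_bilin_ext_left: "lin (\<lambda>x. bilin_ext f x y)"
  unfolding bilin_ext_def by (rule lin_lin_ext)

lemma lin_bilin_ext_right: "lin (bilin_ext f x)"
  unfolding bilin_ext_def lin_ext_def[where x = x] by (intro lin_sum lin_scl lin_lin_ext)

lemma linf_bilin_form_left: "linf (\<lambda>x. bilin_form f x y)"
  unfolding bilin_form_def by (rule linf_lin_form)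

lemma linf_bilin_form_right: "linf (bilin_form f x)"
  unfolding bilin_form_def lin_form_def[where x = x] by (intro linf_sum linf_cmult linf_lin_form)

lemma lin_tens_left: "lin (\<lambda>x. tens x y)"
  unfolding tens_def by (rule lin_bilin_ext_left)

lemma lin_tens_right: "lin (tens x)"
  unfolding tens_def by (rule lin_bilin_ext_right)

lemma tens_basis: "tens (basis a) (basis b) = basis (a, b)"
  by (simp add: tens_def)

lemma lin_tmap: "lin (tmap F G)"
  unfolding tmap_def by (rule lin_lin_ext)

lemma lin_tassoc: "lin tassoc"
  unfolding tassoc_def by (rule lin_lin_ext)

lemma lin_tmul_left: "lin (\<lambda>x. tmul M x y)"
  unfolding tmul_def by (rule lin_bilin_ext_left)

lemma lin_tmul_right: "lin (tmul M x)"
  unfolding tmul_def by (rule lin_bilin_ext_right)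

text \<open>The composition rules have their outer map fixed, so a goal is decomposed from the
  outside and no intermediate map has to be guessed.\<close>

lemmas lin_intros =
  lin_ident lin_id lin_add lin_diff lin_lin_ext lin_tens_left lin_tens_right lin_tmap lin_tassoc
  lin_tmul_left lin_tmul_right
  lin_compose[OF _ lin_lin_ext] lin_compose[OF _ lin_tens_left] lin_compose[OF _ lin_tens_right]
  lin_compose[OF _ lin_tmap] lin_compose[OF _ lin_tassoc] lin_compose[OF _ lin_tmul_left]
  lin_compose[OF _ lin_tmul_right]

lemma tmap_basis: "tmap F G (basis (a, b)) = tens (F (basis a)) (G (basis b))"
  by (simp add: tmap_def)

lemma tmap_tens:
  fixes x :: "'a \<Rightarrow>\<^sub>0 'k::field"
  assumes "lin F" "lin G" shows "tmap F G (tens x y) = tens (F x) (G y)"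
proof (rule lin_eq_on_basis[where x = x])
  fix a :: 'a
  show "tmap F G (tens (basis a) y) = tens (F (basis a)) (G y)"
    by (rule lin_eq_on_basis[where x = y])
      ((intro lin_intros assms)+, simp add: tens_basis tmap_basis)
qed (intro lin_intros assms)+

lemma tassoc_basis: "tassoc (basis ((a, b), c)) = basis (a, b, c)"
  by (simp add: tassoc_def)

lemma tassoc_tens:
  fixes x :: "'a \<Rightarrow>\<^sub>0 'k::field" and y :: "'b \<Rightarrow>\<^sub>0 'k"
  shows "tassoc (tens (tens x y) z) = tens x (tens y z)"
proof (rule lin_eq_on_basis[where x = x])
  fix a :: 'a
  show "tassoc (tens (tens (basis a) y) z) = tens (basis a) (tens y z)"
  proof (rule lin_eq_on_basis[where x = y])
    fix b :: 'b
    show "tassoc (tens (tens (basis a) (basis b)) z) = tens (basis a) (tens (basis b) z)"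
      by (rule lin_eq_on_basis[where x = z])
        ((intro lin_intros)+, simp add: tens_basis tassoc_basis)
  qed (intro lin_intros)+
qed (intro lin_intros)+

lemma tmul_basis:
  "tmul M (basis (a, b)) (basis (c, d)) = tens (M (basis a) (basis c)) (M (basis b) (basis d))"
  by (simp add: tmul_def)

section \<open>Bilinear maps as linear maps on tensor products\<close>

definition bilin :: "(('a \<Rightarrow>\<^sub>0 'k) \<Rightarrow> ('b \<Rightarrow>\<^sub>0 'k) \<Rightarrow> ('c \<Rightarrow>\<^sub>0 'k::field)) \<Rightarrow> bool" where
  "bilin M \<longleftrightarrow> (\<forall>x. lin (M x)) \<and> (\<forall>y. lin (\<lambda>x. M x y))"

lemma bilin_bilin_ext: "bilin (bilin_ext f)"
  by (simp add: bilin_def lin_bilin_ext_left lin_bilin_ext_right)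

lemma bilin_eq_on_basis:
  assumes "bilin M" "bilin N" "\<And>a b. M (basis a) (basis b) = N (basis a) (basis b)"
  shows "M x y = N x y"
proof (rule lin_eq_on_basis[where x = x])
  show "M (basis a) y = N (basis a) y" for a
    by (rule lin_eq_on_basis[where x = y]) (use assms in \<open>auto simp: bilin_def\<close>)
qed (use assms in \<open>auto simp: bilin_def\<close>)

text \<open>The factorisation of \<open>M\<close> through the tensor product. In this form a product
  is a linear map, so a coproduct can be its transpose.\<close>

definition mul_lin :: "(('a \<Rightarrow>\<^sub>0 'k) \<Rightarrow> ('b \<Rightarrow>\<^sub>0 'k) \<Rightarrow> ('c \<Rightarrow>\<^sub>0 'k)) \<Rightarrow> ('a \<times> 'b \<Rightarrow>\<^sub>0 'k) \<Rightarrow>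
  ('c \<Rightarrow>\<^sub>0 'k::field)"
  where "mul_lin M = lin_ext (\<lambda>(a, b). M (basis a) (basis b))"

lemma lin_mul_lin: "lin (mul_lin M)"
  unfolding mul_lin_def by (rule lin_lin_ext)

lemma mul_lin_tens:
  assumes "bilin M" shows "mul_lin M (tens x y) = M x y"
  by (rule bilin_eq_on_basis[where x = x and y = y])
    (use assms in \<open>auto simp: bilin_def mul_lin_def tens_basis intro!: lin_intros\<close>)

definition tswap :: "(('a \<times> 'b) \<times> 'c \<times> 'd \<Rightarrow>\<^sub>0 'k) \<Rightarrow> (('a \<times> 'c) \<times> 'b \<times> 'd \<Rightarrow>\<^sub>0 'k::field)" where
  "tswap = lin_ext (\<lambda>((a, b), (c, d)). basis ((a, c), (b, d)))"

lemma lin_tswap: "lin tswap"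
  unfolding tswap_def by (rule lin_lin_ext)

text \<open>The product of the tensor square is the interchange of the two middle factors followed
  by \<open>M\<close> on each half. This writes it as a composite of maps that can be transposed one
  by one.\<close>

lemma tmul_eq_tswap:
  fixes X :: "'a \<times> 'a \<Rightarrow>\<^sub>0 'k::field"
  assumes "bilin M"
  shows "tmul M X Y = tmap (mul_lin M) (mul_lin M) (tswap (tens X Y))"
proof (rule bilin_eq_on_basis[where x = X and y = Y])
  fix ab cd :: "'a \<times> 'a"
  show "tmul M (basis ab) (basis cd) =
    tmap (mul_lin M) (mul_lin M) (tswap (tens (basis ab) (basis cd)))"
    by (cases ab; cases cd)
      (simp add: tmul_basis tens_basis tswap_def tmap_basis mul_lin_def)
qed (unfold bilin_def, (intro conjI allI lin_intros lin_compose[OF _ lin_tswap])+)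

section \<open>Diagonal forms and duality\<close>

text \<open>The weights are kept abstract so that the same facts apply to the space itself and, with
  product weights, to its tensor powers.\<close>

definition dform :: "('a \<Rightarrow> 'k) \<Rightarrow> ('a \<Rightarrow>\<^sub>0 'k) \<Rightarrow> ('a \<Rightarrow>\<^sub>0 'k) \<Rightarrow> 'k::field" where
  "dform w = bilin_form (\<lambda>p q. if p = q then w p else 0)"

abbreviation wprod :: "('a \<Rightarrow> 'k) \<Rightarrow> ('b \<Rightarrow> 'k) \<Rightarrow> 'a \<times> 'b \<Rightarrow> 'k::field" where
  "wprod w v \<equiv> \<lambda>(a, b). w a * v b"

lemma linf_dform: "linf (dform w x)" "linf (\<lambda>x. dform w x y)"
  unfolding dform_def by (rule linf_bilin_form_right linf_bilin_form_left)+

lemma dform_eq_on_basis: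
  assumes "lin F" "lin F'" "lin G" "lin G'"
    and "\<And>a b. dform w (F (basis a)) (G (basis b)) = dform v (F' (basis a)) (G' (basis b))"
  shows "dform w (F x) (G y) = dform v (F' x) (G' y)"
proof (rule linf_eq_on_basis[where x = x])
  show "dform w (F (basis a)) (G y) = dform v (F' (basis a)) (G' y)" for a
    by (rule linf_eq_on_basis[where x = y])
      (rule linf_compose[OF assms(3)] linf_compose[OF assms(4)] linf_dform assms(5))+
qed (rule linf_compose[OF assms(1)] linf_compose[OF assms(2)] linf_dform)+

lemma dform_basis: "dform w (basis a) (basis b) = (if a = b then w a else 0)"
  by (simp add: dform_def)

lemma dform_basis_right: "dform w x (basis a) = Poly_Mapping.lookup x a * w a"
  by (rule linf_eq_on_basis[where x = x])
    (auto simp: linf_dform dform_basis lookup_basis, simp add: linf_iff lookup_add algebra_simps)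

lemma dform_sym: "dform w x y = dform w y x"
proof (rule linf_eq_on_basis[where x = x])
  show "dform w (basis a) y = dform w y (basis a)" for a
    by (rule linf_eq_on_basis[where x = y]) (auto simp: linf_dform dform_basis)
qed (auto simp: linf_dform)

text \<open>Pairing with \<open>basis a\<close> gives the coefficient at \<open>a\<close> times the
  weight of \<open>a\<close>, and the weight can be cancelled.\<close>

lemma dform_nondegenerate:
  assumes "\<And>a. w a \<noteq> 0" "\<And>b. dform w x (basis b) = dform w y (basis b)"
  shows "x = y"
  by (rule poly_mapping_eqI) (use assms in \<open>simp add: dform_basis_right\<close>)

lemma dform_tens:
  fixes x z :: "'a \<Rightarrow>\<^sub>0 'k::field" and y t :: "'b \<Rightarrow>\<^sub>0 'k"
  shows "dform (wprod w v) (tens x y) (tens z t) = dform w x z * dform v y t"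
proof -
  have 1: "dform (wprod w v) (tens (basis a) (basis b)) (tens z t) =
      dform w (basis a) z * dform v (basis b) t" for a :: 'a and b :: 'b
  proof (rule linf_eq_on_basis[where x = z])
    fix c :: 'a
    show "dform (wprod w v) (tens (basis a) (basis b)) (tens (basis c) t) =
      dform w (basis a) (basis c) * dform v (basis b) t"
      by (rule linf_eq_on_basis[where x = t])
        ((intro linf_dform linf_cmult linf_compose[OF lin_tens_right])+,
          simp add: tens_basis dform_basis)
  qed (intro linf_dform linf_multc linf_compose[OF lin_tens_left])+
  show ?thesis
  proof (rule linf_eq_on_basis[where x = x])
    fix a :: 'a
    show "dform (wprod w v) (tens (basis a) y) (tens z t) = dform w (basis a) z * dform v y t"
      by (rule linf_eq_on_basis[where x = y])
        ((intro linf_dform linf_cmult linf_compose[OF lin_tens_right])+, rule 1)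
  qed (intro linf_dform linf_multc linf_compose[OF lin_tens_left])+
qed

lemma dform_tens_basis:
  "dform (wprod w v) (tens x y) (basis (a, b)) = dform w x (basis a) * dform v y (basis b)"
  "dform (wprod w v) (basis (a, b)) (tens x y) = dform w (basis a) x * dform v (basis b) y"
  by (simp_all only: dform_tens flip: tens_basis)

text \<open>Brings the form on the tensor square that occurs in \<open>dual_bialgebras\<close> under
  the theory of diagonal forms.\<close>

lemma tform_dform: "tform (dform w) = dform (wprod w w)"
proof -
  have "(\<lambda>(a, b) (c, d). dform w (basis a) (basis c) * dform w (basis b) (basis d)) =
    (\<lambda>p q. if p = q then wprod w w p else 0)"
    by (auto simp: fun_eq_iff dform_basis)
  then show ?thesis unfolding tform_def dform_def[of "wprod w w"] by simp
qed

section \<open>Transposes with respect to diagonal forms\<close>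

definition adjoint_wrt ::
  "('a \<Rightarrow> 'k) \<Rightarrow> ('b \<Rightarrow> 'k) \<Rightarrow> (('a \<Rightarrow>\<^sub>0 'k) \<Rightarrow> ('b \<Rightarrow>\<^sub>0 'k)) \<Rightarrow> (('b \<Rightarrow>\<^sub>0 'k) \<Rightarrow> ('a \<Rightarrow>\<^sub>0 'k::field)) \<Rightarrow>
    bool" where
  "adjoint_wrt w v F G \<longleftrightarrow> (\<forall>x y. dform v (F x) y = dform w x (G y))"

lemma adjoint_on_basis:
  assumes "lin F" "lin G"
    and "\<And>a b. dform v (F (basis a)) (basis b) = dform w (basis a) (G (basis b))"
  shows "adjoint_wrt w v F G"
  unfolding adjoint_wrt_def
  using dform_eq_on_basis[OF assms(1) lin_ident lin_ident assms(2) assms(3)] by blast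

lemma adjoint_id: "adjoint_wrt w w id id"
  by (simp add: adjoint_wrt_def)

lemma adjoint_tmap:
  assumes "lin F" "lin F'" "lin G" "lin G'"
    and "adjoint_wrt w w' F F'" "adjoint_wrt v v' G G'"
  shows "adjoint_wrt (wprod w v) (wprod w' v') (tmap F G) (tmap F' G')"
proof (rule adjoint_on_basis[OF lin_tmap lin_tmap])
  fix ab cd
  show "dform (wprod w' v') (tmap F G (basis ab)) (basis cd) =
    dform (wprod w v) (basis ab) (tmap F' G' (basis cd))"
    using assms(5,6)
    by (cases ab; cases cd) (simp add: tmap_basis adjoint_wrt_def dform_tens_basis)
qed

text \<open>The interchange is a weight-preserving bijection of bases, and its inverse is given by
  the same formula.\<close>

lemma adjoint_tswap:
  "adjoint_wrt (wprod (wprod w v) (wprod w' v')) (wprod (wprod w w') (wprod v v')) tswap tswap"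
  by (rule adjoint_on_basis[OF lin_tswap lin_tswap])
    (auto simp: tswap_def dform_basis split: prod.splits)

text \<open>Reassociation is a weight-preserving bijection of bases. Stating this as an isometry
  avoids naming the inverse of \<open>tassoc\<close>.\<close>

lemma dform_tassoc:
  "dform (wprod w (wprod v u)) (tassoc X) (tassoc Y) = dform (wprod (wprod w v) u) X Y"
  by (rule dform_eq_on_basis[OF lin_tassoc lin_ident lin_tassoc lin_ident])
    (auto simp: tassoc_def dform_basis split: prod.splits)

lemma adjoint_mul_lin:
  assumes "lin D"
    and "\<And>x y z. dform w (M x y) z = dform (wprod w w) (tens x y) (D z)"
  shows "adjoint_wrt (wprod w w) w (mul_lin M) D"
proof (rule adjoint_on_basis[OF lin_mul_lin assms(1)])
  fix ab c
  show "dform w (mul_lin M (basis ab)) (basis c) = dform (wprod w w) (basis ab) (D (basis c))"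
    using assms(2) by (cases ab) (simp add: mul_lin_def tens_basis)
qed

text \<open>If \<open>e\<close> is the pairing with \<open>u\<close>, then contracting a tensor
  factor with \<open>e\<close> is the transpose of inserting \<open>u\<close> there. This exchanges
  counit axioms and unit axioms.\<close>

lemma adjoint_tens_counit:
  assumes "\<And>x. dform w u x = e x"
  shows "adjoint_wrt w (wprod w w) (tens u) (lin_ext (\<lambda>(a, b). scl (e (basis a)) (basis b)))"
    "adjoint_wrt w (wprod w w) (\<lambda>x. tens x u) (lin_ext (\<lambda>(a, b). scl (e (basis b)) (basis a)))"
proof -
  have s: "dform w x (scl c y) = c * dform w x y" for c x y
    using linf_dform(1)[of w] by (simp add: linf_iff)
  show "adjoint_wrt w (wprod w w) (tens u) (lin_ext (\<lambda>(a, b). scl (e (basis a)) (basis b)))"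
  proof (rule adjoint_on_basis[OF lin_tens_right lin_lin_ext])
    fix b cd
    show "dform (wprod w w) (tens u (basis b)) (basis cd) =
      dform w (basis b) (lin_ext (\<lambda>(a, b). scl (e (basis a)) (basis b)) (basis cd))"
      by (cases cd) (simp add: s assms dform_tens_basis)
  qed
  show "adjoint_wrt w (wprod w w) (\<lambda>x. tens x u) (lin_ext (\<lambda>(a, b). scl (e (basis b)) (basis a)))"
  proof (rule adjoint_on_basis[OF lin_tens_left lin_lin_ext])
    fix b cd
    show "dform (wprod w w) (tens (basis b) u) (basis cd) =
      dform w (basis b) (lin_ext (\<lambda>(a, b). scl (e (basis b)) (basis a)) (basis cd))"
      by (cases cd) (simp add: s assms dform_tens_basis)
  qed
qed

text \<open>Each axiom is tested against basis elements and becomes an axiom of the other structure: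
  associativity of \<open>M\<close> comes from coassociativity of \<open>D'\<close>, coassociativity
  of \<open>D\<close> from associativity of \<open>M'\<close>, unit and counit are exchanged, and
  the compatibility of product and coproduct is its own transpose. The same \<open>u\<close> and
  \<open>e\<close> serve both sides because \<open>e\<close> is the pairing with
  \<open>u\<close>.\<close>

lemma dual_bialgebra:
  fixes w :: "'a \<Rightarrow> 'k::field"
  assumes w: "\<And>a. w a \<noteq> 0"
    and bi': "bialgebra M' u D' e"
    and M: "bilin M" and D: "lin D"
    and adjM: "\<And>x y z. dform w (M x y) z = dform (wprod w w) (tens x y) (D' z)"
    and adjM': "\<And>x y z. dform w (M' x y) z = dform (wprod w w) (tens x y) (D z)"
    and e: "\<And>x. dform w u x = e x"
  shows "bialgebra M u D e"
proof -
  have alg': "unital_algebra M' u" and coalg': "counital_coalgebra D' e"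
    and compat': "\<And>x y. D' (M' x y) = tmul M' (D' x) (D' y)" and Du': "D' u = tens u u"
    and eM': "\<And>x y. e (M' x y) = e x * e y" and eu: "e u = 1"
    using bi' by (auto simp: bialgebra_def)
  have M': "bilin M'" and assoc': "\<And>x y z. M' (M' x y) z = M' x (M' y z)"
    and unit': "\<And>x. M' u x = x" "\<And>x. M' x u = x"
    using alg' by (auto simp: unital_algebra_def bilin_def)
  have D': "lin D'" and le: "linf e"
    and coassoc': "\<And>x. tassoc (tmap D' id (D' x)) = tmap id D' (D' x)"
    and counit': "\<And>x. lin_ext (\<lambda>(a, b). scl (e (basis a)) (basis b)) (D' x) = x"
      "\<And>x. lin_ext (\<lambda>(a, b). scl (e (basis b)) (basis a)) (D' x) = x"
    using coalg' by (auto simp: counital_coalgebra_def)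
  note aM = adjoint_mul_lin[OF D' adjM] and aM' = adjoint_mul_lin[OF D adjM']
  note counit_adj = adjoint_tens_counit[OF e, unfolded adjoint_wrt_def, rule_format]
  note L = lin_mul_lin lin_id D D'
  \<comment> \<open>The order matters for the later selections: \<open>M\<close>, \<open>M'\<close>,
    then \<open>M\<close> on the first and on the second tensor factor, \<open>M'\<close> likewise,
    and finally \<open>M\<close> and \<open>M'\<close> on both factors.\<close>
  note adj = aM[unfolded adjoint_wrt_def, rule_format] aM'[unfolded adjoint_wrt_def, rule_format]
    adjoint_tmap[OF L(1,4,2,2) aM adjoint_id, unfolded adjoint_wrt_def, rule_format]
    adjoint_tmap[OF L(2,2,1,4) adjoint_id aM, unfolded adjoint_wrt_def, rule_format]
    adjoint_tmap[OF L(1,3,2,2) aM' adjoint_id, unfolded adjoint_wrt_def, rule_format]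
    adjoint_tmap[OF L(2,2,1,3) adjoint_id aM', unfolded adjoint_wrt_def, rule_format]
    adjoint_tmap[OF L(1,4,1,4) aM aM, unfolded adjoint_wrt_def, rule_format]
    adjoint_tmap[OF L(1,3,1,3) aM' aM', unfolded adjoint_wrt_def, rule_format]
  have ww: "\<And>p. wprod w w p \<noteq> 0" and www: "\<And>p. wprod w (wprod w w) p \<noteq> 0"
    using w by auto
  have 1: "M (M x y) z = M x (M y z)" for x y z
  proof (rule dform_nondegenerate[where w = w, OF w])
    fix t :: 'a
    have "dform w (M (M x y) z) (basis t) =
      dform w (mul_lin M (tmap (mul_lin M) id (tens (tens x y) z))) (basis t)"
      by (simp add: tmap_tens[OF lin_mul_lin lin_id] mul_lin_tens[OF M])
    also have "\<dots> = dform (wprod (wprod w w) w) (tens (tens x y) z) (tmap D' id (D' (basis t)))"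
      unfolding adj ..
    \<comment> \<open>Coassociativity of \<open>D'\<close> enters here: both arguments on the right
      are rewritten as images under \<open>tassoc\<close>, which is an isometry.\<close>
    also have "\<dots> = dform (wprod w (wprod w w)) (tens x (tens y z)) (tmap id D' (D' (basis t)))"
      unfolding coassoc'[symmetric] tassoc_tens[symmetric] dform_tassoc ..
    also have "\<dots> = dform w (mul_lin M (tmap id (mul_lin M) (tens x (tens y z)))) (basis t)"
      unfolding adj ..
    also have "\<dots> = dform w (M x (M y z)) (basis t)"
      by (simp add: tmap_tens[OF lin_id lin_mul_lin] mul_lin_tens[OF M])
    finally show "dform w (M (M x y) z) (basis t) = dform w (M x (M y z)) (basis t)" .
  qed
  have 2: "M u x = x" for x
    by (rule dform_nondegenerate[where w = w, OF w]) (simp only: adjM counit_adj counit')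
  have 22: "M x u = x" for x
    by (rule dform_nondegenerate[where w = w, OF w]) (simp only: adjM counit_adj counit')
  have 3: "tassoc (tmap D id (D x)) = tmap id D (D x)" for x
  proof (rule dform_nondegenerate[where w = "wprod w (wprod w w)", OF www])
    fix t :: "'a \<times> 'a \<times> 'a"
    obtain a b c where t: "t = (a, b, c)" by (cases t)
    \<comment> \<open>The basis triple is bracketed in both ways, so that transposition yields the
      two iterated products of \<open>M'\<close>.\<close>
    have t1: "(basis t :: 'a \<times> 'a \<times> 'a \<Rightarrow>\<^sub>0 'k) = tassoc (tens (tens (basis a) (basis b)) (basis c))"
      and t2: "(basis t :: 'a \<times> 'a \<times> 'a \<Rightarrow>\<^sub>0 'k) = tens (basis a) (tens (basis b) (basis c))"
      by (simp_all add: t tens_basis tassoc_basis)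
    have "dform (wprod w (wprod w w)) (tassoc (tmap D id (D x))) (basis t) =
      dform (wprod (wprod w w) w) (tens (tens (basis a) (basis b)) (basis c)) (tmap D id (D x))"
      unfolding t1 dform_tassoc by (rule dform_sym)
    also have "\<dots> = dform w (M' (M' (basis a) (basis b)) (basis c)) x"
      by (simp add: adj(2,5)[symmetric] tmap_tens[OF lin_mul_lin lin_id] mul_lin_tens[OF M'])
    also have "\<dots> = dform (wprod w (wprod w w)) (basis t) (tmap id D (D x))"
      unfolding t2 assoc'
      by (simp add: adj(2,6)[symmetric] tmap_tens[OF lin_id lin_mul_lin] mul_lin_tens[OF M'])
    finally show "dform (wprod w (wprod w w)) (tassoc (tmap D id (D x))) (basis t) =
        dform (wprod w (wprod w w)) (tmap id D (D x)) (basis t)"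
      unfolding dform_sym[of _ "basis t"] .
  qed
  have 4: "lin_ext (\<lambda>(a, b). scl (e (basis a)) (basis b)) (D x) = x" for x
    by (rule dform_nondegenerate[where w = w, OF w])
      (simp only: dform_sym[of w _ "basis _"] counit_adj[symmetric] adjM'[symmetric] unit')
  have 44: "lin_ext (\<lambda>(a, b). scl (e (basis b)) (basis a)) (D x) = x" for x
    by (rule dform_nondegenerate[where w = w, OF w])
      (simp only: dform_sym[of w _ "basis _"] counit_adj[symmetric] adjM'[symmetric] unit')
  have 5: "D (M x y) = tmul M (D x) (D y)" for x y
  proof (rule dform_nondegenerate[where w = "wprod w w", OF ww])
    fix t :: "'a \<times> 'a"
    obtain a b where t: "(basis t :: 'a \<times> 'a \<Rightarrow>\<^sub>0 'k) = tens (basis a) (basis b)"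
      by (cases t) (simp add: tens_basis)
    let ?w4 = "wprod (wprod w w) (wprod w w)"
    \<comment> \<open>\<open>D\<close> and \<open>M\<close> cross the form as \<open>M'\<close> and
      \<open>D'\<close>, the compatibility of \<open>M'\<close> and \<open>D'\<close> is applied
      there, and the self-adjoint interchange allows everything to be moved back.\<close>
    have "dform (wprod w w) (D (M x y)) (basis t) = dform w (M x y) (M' (basis a) (basis b))"
      unfolding t dform_sym[of _ "D (M x y)"] dform_sym[of _ "M x y"] adjM' ..
    also have "\<dots> = dform (wprod w w) (tens x y)
        (tmap (mul_lin M') (mul_lin M') (tswap (tens (D' (basis a)) (D' (basis b)))))"
      unfolding adjM compat' tmul_eq_tswap[OF M'] ..
    also have "\<dots> = dform ?w4 (tswap (tens (D' (basis a)) (D' (basis b)))) (tmap D D (tens x y))"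
      unfolding adj(8)[symmetric] by (rule dform_sym)
    also have "\<dots> = dform ?w4 (tens (D' (basis a)) (D' (basis b))) (tswap (tens (D x) (D y)))"
      using adjoint_tswap[of w w w w] unfolding adjoint_wrt_def tmap_tens[OF D D] by blast
    also have "\<dots> = dform ?w4 (tswap (tens (D x) (D y))) (tmap D' D' (basis t))"
      unfolding t tmap_tens[OF D' D'] by (rule dform_sym)
    also have "\<dots> = dform (wprod w w) (tmul M (D x) (D y)) (basis t)"
      unfolding adj tmul_eq_tswap[OF M] ..
    finally show "dform (wprod w w) (D (M x y)) (basis t) =
      dform (wprod w w) (tmul M (D x) (D y)) (basis t)" .
  qed
  have 6: "D u = tens u u"
  proof (rule dform_nondegenerate[where w = "wprod w w", OF ww])
    fix t :: "'a \<times> 'a"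
    obtain a b where t: "(basis t :: 'a \<times> 'a \<Rightarrow>\<^sub>0 'k) = tens (basis a) (basis b)"
      by (cases t) (simp add: tens_basis)
    \<comment> \<open>Tested against a tensor of basis elements, this is the multiplicativity of
      \<open>e\<close> for \<open>M'\<close>.\<close>
    show "dform (wprod w w) (D u) (basis t) = dform (wprod w w) (tens u u) (basis t)"
      unfolding t dform_tens e dform_sym[of _ "D u"] adjM'[symmetric]
      by (simp add: dform_sym[of _ _ u] e eM')
  qed
  \<comment> \<open>Conversely, multiplicativity of \<open>e\<close> for \<open>M\<close> is the
    transpose of \<open>D' u = tens u u\<close>.\<close>
  have 7: "e (M x y) = e x * e y" for x y
    unfolding e[symmetric] dform_sym[of _ u] adjM Du' dform_tens ..
  show ?thesis
    using M D le 1 2 22 3 4 44 5 6 7 eu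
    unfolding bialgebra_def unital_algebra_def counital_coalgebra_def bilin_def by blast
qed

section \<open>Upper sets and restrictions\<close>

lemma fposetD:
  assumes "fposet r"
  shows "\<And>x. x \<in> Field r \<Longrightarrow> (x, x) \<in> r" "\<And>x y z. (x, y) \<in> r \<Longrightarrow> (y, z) \<in> r \<Longrightarrow> (x, z) \<in> r"
    "\<And>x y. (x, y) \<in> r \<Longrightarrow> (y, x) \<in> r \<Longrightarrow> x = y" "finite (Field r)"
  using assms unfolding fposet_iff trans_def antisym_def by blast+

lemma Field_Restr:
  assumes "fposet r" "I \<subseteq> Field r" shows "Field (Restr r I) = I"
  using fposetD(1)[OF assms(1)] assms(2) unfolding Field_def by blast

lemma fposet_Restr:
  assumes "fposet r" "I \<subseteq> Field r" shows "fposet (Restr r I)"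
  unfolding fposet_iff Field_Restr[OF assms]
  using fposetD[OF assms(1)] assms(2) finite_subset[OF assms(2)]
  by (auto intro!: transI antisymI)

lemma Restr_Restr: "J \<subseteq> I \<Longrightarrow> Restr (Restr r I) J = Restr r J"
  by blast

lemma Restr_Field: "Restr r (Field r) = r"
  by (auto intro: FieldI1 FieldI2)

definition upsets :: "'a rel \<Rightarrow> 'a set set" where
  "upsets r = {I. I \<subseteq> Field r \<and> before r (Field r - I) I}"

text \<open>The complement of \<open>I\<close> is before \<open>I\<close> exactly when no relation
  leads out of \<open>I\<close>. The upper element may range over the whole type, since related
  elements lie in the field.\<close>

lemma upsets_iff: "I \<in> upsets r \<longleftrightarrow> I \<subseteq> Field r \<and> (\<forall>x\<in>I. \<forall>y. (x, y) \<in> r \<longrightarrow> y \<in> I)"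
  unfolding upsets_def before_def by (auto intro: FieldI2)

lemma upsets_subset: "I \<in> upsets r \<Longrightarrow> I \<subseteq> Field r"
  by (simp add: upsets_iff)

lemma finite_upsets: "fposet r \<Longrightarrow> finite (upsets r)"
  by (rule finite_subset[where B = "Pow (Field r)"]) (auto simp: upsets_iff fposet_def)

lemma coprod_star_of_eq:
  "coprod_star_of r =
    (\<Sum>I\<in>upsets r. basis (iso_class (Restr r (Field r - I)), iso_class (Restr r I)))"
  by (simp add: coprod_star_of_def upsets_def)

lemma upsets_Restr:
  assumes "fposet r" "I \<subseteq> Field r"
  shows "J \<in> upsets (Restr r I) \<longleftrightarrow> J \<subseteq> I \<and> (\<forall>x\<in>J. \<forall>y\<in>I. (x, y) \<in> r \<longrightarrow> y \<in> J)"
  unfolding upsets_iff Field_Restr[OF assms] by blast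

text \<open>Passes from a basis element to a concrete order on the naturals, so that the formulas
  for arbitrary representatives apply.\<close>

lemma poset_class_cases:
  assumes "\<And>r :: nat rel. fposet r \<Longrightarrow> p = iso_class r \<Longrightarrow> thesis"
  shows thesis
  using assms[OF fposet_rep[of p]] by simp

lemma iso_class_empty_iff:
  assumes "fposet r" shows "iso_class r = iso_class ({} :: nat rel) \<longleftrightarrow> r = {}"
proof -
  have "poset_iso r ({} :: nat rel) \<longleftrightarrow> r = {}"
    using assms by (cases "r = {}") (simp_all add: poset_iso_iff)
  then show ?thesis using iso_class_eq_iff[OF assms fposet_empty[where 'a = nat]] by simp
qed

text \<open>The empty order on the left may have any carrier type, so the unit can be written over
  the type of any poset at hand.\<close>

lemma iso_class_empty: "iso_class {} = iso_class ({} :: nat rel)"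
  by (simp add: iso_class_empty_iff fposet_empty)

section \<open>The products by disjoint union and by ordinal sum\<close>

definition sum_assoc :: "('a + 'b) + 'c \<Rightarrow> 'a + 'b + 'c" where
  "sum_assoc = case_sum (case_sum Inl (Inr \<circ> Inl)) (Inr \<circ> Inr)"

lemma sum_assoc_simps [simp]:
  "sum_assoc (Inl (Inl a)) = Inl a" "sum_assoc (Inl (Inr b)) = Inr (Inl b)"
  "sum_assoc (Inr c) = Inr (Inr c)"
  by (simp_all add: sum_assoc_def)

lemma bij_betw_sum_assoc: "bij_betw sum_assoc ((A <+> B) <+> C) (A <+> (B <+> C))"
proof -
  have "inj sum_assoc"
    by (rule injI) (auto simp: sum_assoc_def split: sum.splits)
  moreover have "sum_assoc ` ((A <+> B) <+> C) = A <+> (B <+> C)"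
    unfolding Plus_def image_Un by (simp add: image_image Un_assoc)
  ultimately show ?thesis unfolding bij_betw_def by (blast intro: inj_on_subset)
qed

lemma iso_class_disj_union_assoc:
  assumes "fposet r" "fposet s" "fposet t"
  shows "iso_class (disj_union (disj_union r s) t) = iso_class (disj_union r (disj_union s t))"
proof (rule iso_class_eqI, rule poset_isoI)
  show "is_iso (disj_union (disj_union r s) t) (disj_union r (disj_union s t)) sum_assoc"
    by (rule is_isoI) (auto simp: bij_betw_sum_assoc)
qed (intro fposet_disj_union assms)

lemma iso_class_ord_sum_assoc:
  assumes "fposet r" "fposet s" "fposet t"
  shows "iso_class (ord_sum (ord_sum r s) t) = iso_class (ord_sum r (ord_sum s t))"
proof (rule iso_class_eqI, rule poset_isoI)
  show "is_iso (ord_sum (ord_sum r s) t) (ord_sum r (ord_sum s t)) sum_assoc"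
    by (rule is_isoI) (auto simp: bij_betw_sum_assoc)
qed (intro fposet_ord_sum assms)

lemma iso_class_disj_union_empty:
  assumes "fposet r"
  shows "iso_class (disj_union {} r) = iso_class r" "iso_class (disj_union r {}) = iso_class r"
proof -
  have "iso_class r = iso_class (disj_union {} r)"
    by (rule iso_class_eqI, rule poset_isoI[OF assms, where f = Inr])
      (auto simp: is_iso_iff disj_union_def)
  then show "iso_class (disj_union {} r) = iso_class r" ..
  have "iso_class r = iso_class (disj_union r {})"
    by (rule iso_class_eqI, rule poset_isoI[OF assms, where f = Inl])
      (auto simp: is_iso_iff disj_union_def)
  then show "iso_class (disj_union r {}) = iso_class r" ..
qed

lemma ord_sum_empty: "ord_sum {} r = disj_union {} r" "ord_sum r {} = disj_union r {}"
  by (simp_all add: ord_sum_def)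

section \<open>Bilinearity and the two unital algebras\<close>

lemma bilin_products: "bilin prod_m" "bilin prod_down" "bilin prod_star"
  by (simp_all add: prod_m_def prod_down_def prod_star_def bilin_bilin_ext)

lemma lin_coproducts: "lin coprod" "lin coprod_star" "linf counit"
  by (simp_all add: coprod_def coprod_star_def counit_def lin_lin_ext linf_lin_form)

lemma bilin_lin:
  assumes "bilin M"
  shows "lin (M x)" "lin (\<lambda>x. M x y)"
    "lin F \<Longrightarrow> lin (\<lambda>x. M z (F x))" "lin F \<Longrightarrow> lin (\<lambda>x. M (F x) z)"
  using assms unfolding bilin_def by (auto intro: lin_compose)

lemma unital_algebra_on_basis:
  assumes M: "bilin M"
    and "\<And>a b c. M (M (basis a) (basis b)) (basis c) = M (basis a) (M (basis b) (basis c))"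
    and "\<And>a. M u (basis a) = basis a" "\<And>a. M (basis a) u = basis a"
  shows "unital_algebra M u"
proof -
  note L = bilin_lin[OF M] bilin_lin(3)[OF M bilin_lin(1)[OF M]]
    bilin_lin(3)[OF M bilin_lin(2)[OF M]]
    bilin_lin(4)[OF M bilin_lin(1)[OF M]] bilin_lin(4)[OF M bilin_lin(2)[OF M]] lin_ident
  have 1: "M (M (basis a) (basis b)) z = M (basis a) (M (basis b) z)" for a b z
    by (rule lin_eq_on_basis[where x = z]) (rule L assms(2))+
  have 2: "M (M (basis a) y) z = M (basis a) (M y z)" for a y z
    by (rule lin_eq_on_basis[where x = y]) (rule L 1)+
  have 3: "M (M x y) z = M x (M y z)" for x y z
    by (rule lin_eq_on_basis[where x = x]) (rule L 2)+
  have 4: "M u x = x" for x by (rule lin_eq_on_basis[where x = x]) (rule L assms(3))+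
  have 5: "M x u = x" for x by (rule lin_eq_on_basis[where x = x]) (rule L assms(4))+
  show ?thesis unfolding unital_algebra_def using 3 4 5 L(1,2) by blast
qed

lemma unital_algebra_prod_m: "unital_algebra prod_m (unit_poset :: 'k::field poset_space)"
proof (rule unital_algebra_on_basis[OF bilin_products(1)])
  fix p q p'
  obtain r s t :: "nat rel" where "fposet r" "p = iso_class r" "fposet s" "q = iso_class s"
    "fposet t" "p' = iso_class t"
    using poset_class_cases[of p] poset_class_cases[of q] poset_class_cases[of p'] by metis
  then show "prod_m (prod_m (basis p) (basis q)) (basis p') =
    prod_m (basis p) (prod_m (basis q) (basis p') :: 'k poset_space)"
    by (simp add: prod_m_iso_class fposet_disj_union iso_class_disj_union_assoc)
next
  fix p
  obtain r :: "nat rel" where "fposet r" "p = iso_class r" by (rule poset_class_cases)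
  then show "prod_m unit_poset (basis p) = (basis p :: 'k poset_space)"
    "prod_m (basis p) unit_poset = (basis p :: 'k poset_space)"
    by (simp_all add: unit_poset_def prod_m_iso_class fposet_empty iso_class_disj_union_empty)
qed

lemma unital_algebra_prod_down: "unital_algebra prod_down (unit_poset :: 'k::field poset_space)"
proof (rule unital_algebra_on_basis[OF bilin_products(2)])
  fix p q p'
  obtain r s t :: "nat rel" where "fposet r" "p = iso_class r" "fposet s" "q = iso_class s"
    "fposet t" "p' = iso_class t"
    using poset_class_cases[of p] poset_class_cases[of q] poset_class_cases[of p'] by metis
  then show "prod_down (prod_down (basis p) (basis q)) (basis p') =
    prod_down (basis p) (prod_down (basis q) (basis p') :: 'k poset_space)"
    by (simp add: prod_down_iso_class fposet_ord_sum iso_class_ord_sum_assoc)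
next
  fix p
  obtain r :: "nat rel" where "fposet r" "p = iso_class r" by (rule poset_class_cases)
  then show "prod_down unit_poset (basis p) = (basis p :: 'k poset_space)"
    "prod_down (basis p) unit_poset = (basis p :: 'k poset_space)"
    by (simp_all add: unit_poset_def prod_down_iso_class fposet_empty ord_sum_empty
      iso_class_disj_union_empty)
qed

section \<open>The coproduct by upper sets\<close>

lemma empty_in_upsets: "{} \<in> upsets r" and Field_in_upsets: "Field r \<in> upsets r"
  by (auto simp: upsets_iff intro: FieldI2)

lemma Restr_eq_empty_iff: "fposet r \<Longrightarrow> I \<subseteq> Field r \<Longrightarrow> Restr r I = {} \<longleftrightarrow> I = {}"
  using Field_Restr[of r I] by auto

text \<open>The counit kills every cut in which the part it is applied to is non-empty. Only
  \<open>I = Field r\<close> survives in the first identity and only \<open>I = {}\<close> in the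
  second.\<close>

lemma coprod_star_counit:
  fixes r :: "'a rel"
  assumes r: "fposet r"
  shows "lin_ext (\<lambda>(a, b). scl (counit (basis a)) (basis b)) (coprod_star_of r) =
    (basis (iso_class r) :: 'k::field poset_space)"
    "lin_ext (\<lambda>(a, b). scl (counit (basis b)) (basis a)) (coprod_star_of r) =
      (basis (iso_class r) :: 'k::field poset_space)"
proof -
  have c: "counit (basis (iso_class (Restr r I))) = (if I = {} then 1 else 0 :: 'k)"
    if "I \<subseteq> Field r" for I
    using counit_iso_class[OF fposet_Restr[OF r that]] Restr_eq_empty_iff[OF r that] by simp
  have "lin_ext (\<lambda>(a, b). scl (counit (basis a)) (basis b)) (coprod_star_of r) =
    (\<Sum>I\<in>upsets r. if Field r = I then basis (iso_class (Restr r I)) :: 'k poset_space else 0)"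
    unfolding coprod_star_of_eq lin_of_sum[OF lin_lin_ext] lin_ext_basis
  proof (rule sum.cong[OF refl])
    fix I assume "I \<in> upsets r"
    then have I: "I \<subseteq> Field r" by (rule upsets_subset)
    show "(case (iso_class (Restr r (Field r - I)), iso_class (Restr r I)) of
        (a, b) \<Rightarrow> scl (counit (basis a)) (basis b)) =
      (if Field r = I then basis (iso_class (Restr r I)) :: 'k poset_space else 0)"
      using I unfolding split c[OF Diff_subset] by (auto simp: scl_simps)
  qed
  then show "lin_ext (\<lambda>(a, b). scl (counit (basis a)) (basis b)) (coprod_star_of r) =
    (basis (iso_class r) :: 'k::field poset_space)"
    by (simp add: sum.delta finite_upsets[OF r] Field_in_upsets Restr_Field)
  have "lin_ext (\<lambda>(a, b). scl (counit (basis b)) (basis a)) (coprod_star_of r) =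
    (\<Sum>I\<in>upsets r. if {} = I
      then basis (iso_class (Restr r (Field r - I))) :: 'k poset_space else 0)"
    unfolding coprod_star_of_eq lin_of_sum[OF lin_lin_ext] lin_ext_basis
  proof (rule sum.cong[OF refl])
    fix I assume "I \<in> upsets r"
    then have I: "I \<subseteq> Field r" by (rule upsets_subset)
    show "(case (iso_class (Restr r (Field r - I)), iso_class (Restr r I)) of
        (a, b) \<Rightarrow> scl (counit (basis b)) (basis a)) =
      (if {} = I then basis (iso_class (Restr r (Field r - I))) :: 'k poset_space else 0)"
      unfolding split c[OF I] by (auto simp: scl_simps)
  qed
  then show "lin_ext (\<lambda>(a, b). scl (counit (basis b)) (basis a)) (coprod_star_of r) =
    (basis (iso_class r) :: 'k::field poset_space)"
    by (simp add: sum.delta finite_upsets[OF r] empty_in_upsets Restr_Field)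
qed

text \<open>Both iterated coproducts run over the chains of two nested upper sets. On the left the
  smaller one is \<open>I\<close> and the larger one is \<open>I \<union> J\<close>; on the right
  they are \<open>J\<close> and \<open>I\<close>. The bijection matches these chains, and the three
  blocks agree.\<close>

lemma coprod_star_coassoc:
  fixes r :: "'a rel"
  assumes r: "fposet r"
  shows "tassoc (tmap coprod_star id (coprod_star_of r)) =
    (tmap id coprod_star (coprod_star_of r)
      :: (poset_class \<times> poset_class \<times> poset_class \<Rightarrow>\<^sub>0 'k::field))"
proof -
  define F where "F = Field r"
  \<comment> \<open>The three arguments are the blocks of a double cut from bottom to top.\<close>
  define B :: "'a set \<Rightarrow> 'a set \<Rightarrow> 'a set \<Rightarrow> (poset_class \<times> poset_class \<times> poset_class \<Rightarrow>\<^sub>0 'k)" where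
    "B I J K = basis (iso_class (Restr r I), iso_class (Restr r J), iso_class (Restr r K))"
    for I J K
  have R: "fposet (Restr r I)" "Field (Restr r I) = I" if "I \<subseteq> F" for I
    using fposet_Restr[OF r] Field_Restr[OF r] that unfolding F_def by auto
  have D: "coprod_star_of (Restr r I) = (\<Sum>J\<in>upsets (Restr r I).
      basis (iso_class (Restr r (I - J)), iso_class (Restr r J)) :: 'k poset_space2)"
        if "I \<subseteq> F" for I
    unfolding coprod_star_of_eq R(2)[OF that]
    by (rule sum.cong) (use upsets_subset[of _ "Restr r I"] R(2)[OF that] in \<open>auto
      simp: Restr_Restr\<close>)
  have 1: "tassoc (tmap coprod_star id (coprod_star_of r)) =
    (\<Sum>I\<in>upsets r. \<Sum>J\<in>upsets (Restr r (F - I)). B (F - I - J) J I)"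
    unfolding coprod_star_of_eq lin_of_sum[OF lin_tmap] lin_of_sum[OF lin_tassoc]
  proof (rule sum.cong[OF refl])
    fix I assume "I \<in> upsets r"
    then have FI: "F - I \<subseteq> F" by (auto simp: upsets_iff F_def)
    show "tassoc (tmap coprod_star id (basis
        (iso_class (Restr r (Field r - I)), iso_class (Restr r I)))) =
      (\<Sum>J\<in>upsets (Restr r (F - I)). B (F - I - J) J I)"
      unfolding tmap_basis F_def[symmetric] coprod_star_iso_class[OF R(1)[OF FI]] D[OF FI]
        lin_of_sum[OF lin_tens_left] lin_of_sum[OF lin_tassoc]
          by (simp add: tens_basis tassoc_basis B_def)
  qed
  have 2: "tmap id coprod_star (coprod_star_of r) =
    (\<Sum>I\<in>upsets r. \<Sum>J\<in>upsets (Restr r I). B (F - I) (I - J) J)"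
    unfolding coprod_star_of_eq lin_of_sum[OF lin_tmap]
  proof (rule sum.cong[OF refl])
    fix I assume "I \<in> upsets r"
    then have FI: "I \<subseteq> F" by (auto simp: upsets_iff F_def)
    show "tmap id coprod_star (basis (iso_class (Restr r (Field r - I)), iso_class (Restr r I))) =
      (\<Sum>J\<in>upsets (Restr r I). B (F - I) (I - J) J)"
      unfolding tmap_basis F_def[symmetric] coprod_star_iso_class[OF R(1)[OF FI]] D[OF FI]
        lin_of_sum[OF lin_tens_right] by (simp add: tens_basis B_def)
  qed
  have U: "I \<in> upsets r \<longleftrightarrow> I \<subseteq> F \<and> (\<forall>x\<in>I. \<forall>y\<in>F. (x, y) \<in> r \<longrightarrow> y \<in> I)" for I
    unfolding upsets_iff F_def by (auto intro: FieldI2)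
  have UR: "J \<in> upsets (Restr r I) \<longleftrightarrow> J \<subseteq> I \<and> (\<forall>x\<in>J. \<forall>y\<in>I. (x, y) \<in> r \<longrightarrow> y \<in> J)" if "I \<subseteq> F" for I J
    using upsets_Restr[OF r] that unfolding F_def by blast
  have fin: "finite (upsets (Restr r I))" if "I \<subseteq> F" for I using finite_upsets[OF R(1)[OF that]] .
  let ?S = "Sigma (upsets r) (\<lambda>I. upsets (Restr r (F - I)))"
    and ?T = "Sigma (upsets r) (\<lambda>I. upsets (Restr r I))"
  have S: "(I, J) \<in> ?S \<longleftrightarrow> I \<in> upsets r \<and> J \<subseteq> F - I \<and> (\<forall>x\<in>J. \<forall>y\<in>F - I. (x, y) \<in> r \<longrightarrow> y \<in> J)" for I J
    using UR[of "F - I"] by auto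
  have T: "(I, J) \<in> ?T \<longleftrightarrow> I \<in> upsets r \<and> J \<subseteq> I \<and> (\<forall>x\<in>J. \<forall>y\<in>I. (x, y) \<in> r \<longrightarrow> y \<in> J)" for I J
    using UR[of I] U by auto
  have "(\<Sum>I\<in>upsets r. \<Sum>J\<in>upsets (Restr r (F - I)). B (F - I - J) J I) =
    (\<Sum>(I, J)\<in>?S. B (F - I - J) J I)"
    by (rule sum.Sigma) (auto simp: finite_upsets[OF r] fin)
  also have "\<dots> = (\<Sum>(I, J)\<in>?T. B (F - I) (I - J) J)"
  proof (rule sum.reindex_bij_witness[where i = "\<lambda>(I, J). (J, I - J)"
        and j = "\<lambda>(I, J). (I \<union> J, I)"])
    fix a assume a: "a \<in> ?S"
    obtain I J where IJ: "a = (I, J)" by (cases a)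
    have h: "I \<subseteq> F" "J \<subseteq> F - I" "\<And>x y. x \<in> I \<Longrightarrow> y \<in> F \<Longrightarrow> (x, y) \<in> r \<Longrightarrow> y \<in> I"
      "\<And>x y. x \<in> J \<Longrightarrow> y \<in> F - I \<Longrightarrow> (x, y) \<in> r \<Longrightarrow> y \<in> J"
      using a unfolding IJ S U by blast+
    have e: "I \<union> J - I = J" "F - I - J = F - (I \<union> J)" using h(2) by blast+
    show "(case case a of (I, J) \<Rightarrow> (I \<union> J, I) of (I, J) \<Rightarrow> (J, I - J)) = a"
      using e by (simp add: IJ)
    show "(case a of (I, J) \<Rightarrow> (I \<union> J, I)) \<in> ?T"
      unfolding IJ split T U using h by blast
    show "(case case a of (I, J) \<Rightarrow> (I \<union> J, I) of (I, J) \<Rightarrow> B (F - I) (I - J) J) =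
      (case a of (I, J) \<Rightarrow> B (F - I - J) J I)"
      using e by (simp add: IJ)
  next
    fix a assume a: "a \<in> ?T"
    obtain I J where IJ: "a = (I, J)" by (cases a)
    have h: "I \<subseteq> F" "J \<subseteq> I" "\<And>x y. x \<in> I \<Longrightarrow> y \<in> F \<Longrightarrow> (x, y) \<in> r \<Longrightarrow> y \<in> I"
      "\<And>x y. x \<in> J \<Longrightarrow> y \<in> I \<Longrightarrow> (x, y) \<in> r \<Longrightarrow> y \<in> J"
      using a unfolding IJ T U by blast+
    show "(case case a of (I, J) \<Rightarrow> (J, I - J) of (I, J) \<Rightarrow> (I \<union> J, I)) = a"
      using h(2) by (auto simp: IJ)
    show "(case a of (I, J) \<Rightarrow> (J, I - J)) \<in> ?S"
      unfolding IJ split S U using h by blast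
  qed
  also have "\<dots> = (\<Sum>I\<in>upsets r. \<Sum>J\<in>upsets (Restr r I). B (F - I) (I - J) J)"
    by (rule sum.Sigma[symmetric]) (auto simp: finite_upsets[OF r] fin U)
  finally show ?thesis using 1 2 by simp
qed

lemma counital_coalgebra_coprod_star:
  "counital_coalgebra coprod_star (counit :: 'k::field poset_space \<Rightarrow> 'k)"
proof -
  have 1: "tassoc (tmap coprod_star id (coprod_star x)) = tmap id coprod_star (coprod_star x)"
    for x :: "'k poset_space"
  proof (rule lin_eq_on_basis[where x = x])
    fix p
    obtain r :: "nat rel" where "fposet r" "p = iso_class r" by (rule poset_class_cases)
    then show "tassoc (tmap coprod_star id (coprod_star (basis p))) =
      (tmap id coprod_star (coprod_star (basis p))
        :: (poset_class \<times> poset_class \<times> poset_class \<Rightarrow>\<^sub>0 'k))"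
      by (simp add: coprod_star_iso_class coprod_star_coassoc)
  qed (intro lin_intros lin_coproducts)+
  have 2: "lin_ext (\<lambda>(a, b). scl (counit (basis a)) (basis b)) (coprod_star x) = x"
    for x :: "'k poset_space"
  proof (rule lin_eq_on_basis[where x = x])
    fix p
    obtain r :: "nat rel" where "fposet r" "p = iso_class r" by (rule poset_class_cases)
    then show "lin_ext (\<lambda>(a, b). scl (counit (basis a)) (basis b)) (coprod_star (basis p)) =
      (basis p :: 'k poset_space)"
      by (simp add: coprod_star_iso_class coprod_star_counit)
  qed (intro lin_intros lin_coproducts)+
  have 3: "lin_ext (\<lambda>(a, b). scl (counit (basis b)) (basis a)) (coprod_star x) = x"
    for x :: "'k poset_space"
  proof (rule lin_eq_on_basis[where x = x])
    fix p
    obtain r :: "nat rel" where "fposet r" "p = iso_class r" by (rule poset_class_cases)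
    then show "lin_ext (\<lambda>(a, b). scl (counit (basis b)) (basis a)) (coprod_star (basis p)) =
      (basis p :: 'k poset_space)"
      by (simp add: coprod_star_iso_class coprod_star_counit)
  qed (intro lin_intros lin_coproducts)+
  show ?thesis unfolding counital_coalgebra_def using lin_coproducts 1 2 3 by blast
qed

section \<open>Compatibilities\<close>

lemma Restr_disj_union: "Restr (disj_union r s) (I <+> J) = disj_union (Restr r I) (Restr s J)"
proof (intro set_eqI iffI)
  fix z assume "z \<in> Restr (disj_union r s) (I <+> J)"
  then show "z \<in> disj_union (Restr r I) (Restr s J)"
    by (cases z; cases "fst z"; cases "snd z") auto
next
  fix z assume "z \<in> disj_union (Restr r I) (Restr s J)"
  then show "z \<in> Restr (disj_union r s) (I <+> J)"
    by (cases z; cases "fst z"; cases "snd z") auto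
qed

lemma Restr_ord_sum:
  assumes "fposet r" "fposet s" "I \<subseteq> Field r" "J \<subseteq> Field s"
  shows "Restr (ord_sum r s) (I <+> J) = ord_sum (Restr r I) (Restr s J)"
proof (intro set_eqI iffI)
  have F: "Field (Restr r I) = I" "Field (Restr s J) = J" by (simp_all add: Field_Restr assms)
  fix z
  {
    assume "z \<in> Restr (ord_sum r s) (I <+> J)"
    then show "z \<in> ord_sum (Restr r I) (Restr s J)"
      using F by (cases z; cases "fst z"; cases "snd z") auto
  next
    assume "z \<in> ord_sum (Restr r I) (Restr s J)"
    then show "z \<in> Restr (ord_sum r s) (I <+> J)"
      using F assms(3,4) by (cases z; cases "fst z"; cases "snd z") auto
  }
qed

lemma Plus_diff: "(A <+> B) - (I <+> J) = (A - I) <+> (B - J)"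
  by auto

lemma ex_Plus: "\<exists>A B. K = A <+> B"
proof
  show "\<exists>B. K = {a. Inl a \<in> K} <+> B"
  proof
    show "K = {a. Inl a \<in> K} <+> {b. Inr b \<in> K}"
      by (rule set_eqI, case_tac x) auto
  qed
qed

lemma Plus_subset_iff: "I <+> J \<subseteq> A <+> B \<longleftrightarrow> I \<subseteq> A \<and> J \<subseteq> B"
  by (auto simp: Plus_def)

lemma Plus_eq_iff: "A <+> B = A' <+> B' \<longleftrightarrow> A = A' \<and> B = B'"
  unfolding set_eq_subset Plus_subset_iff by blast

lemma ball_Plus: "(\<forall>x\<in>I <+> J. P x) \<longleftrightarrow> (\<forall>a\<in>I. P (Inl a)) \<and> (\<forall>b\<in>J. P (Inr b))"
  by (auto simp: Plus_def)

text \<open>Without relations across the summands, upward closure is tested on each of them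
  separately.\<close>

lemma upsets_disj_union: "upsets (disj_union r s) = (\<lambda>(I, J). I <+> J) ` (upsets r \<times> upsets s)"
proof -
  have e: "I <+> J \<in> upsets (disj_union r s) \<longleftrightarrow> I \<in> upsets r \<and> J \<in> upsets s" for I J
    unfolding upsets_iff Field_disj_union Plus_subset_iff ball_Plus split_sum_all by simp blast
  show ?thesis
  proof (intro set_eqI iffI)
    fix K assume "K \<in> upsets (disj_union r s)"
    moreover obtain I J where "K = I <+> J" using ex_Plus[of K] by blast
    ultimately show "K \<in> (\<lambda>(I, J). I <+> J) ` (upsets r \<times> upsets s)" using e by auto
  qed (use e in auto)
qed

text \<open>As soon as an upper set meets the lower summand, it contains the whole upper summand;
  otherwise it lies inside the upper one.\<close>

lemma upsets_ord_sum:
  "upsets (ord_sum r s) = (\<lambda>I. I <+> Field s) ` upsets r \<union> (\<lambda>J. {} <+> J) ` upsets s"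
proof -
  have e: "I <+> J \<in> upsets (ord_sum r s) \<longleftrightarrow> I \<in> upsets r \<and> J = Field s \<or>
    I = {} \<and> J \<in> upsets s" for I J
    unfolding upsets_iff Field_ord_sum Plus_subset_iff ball_Plus split_sum_all
    by (simp, intro iffI conjI impI) (blast intro: FieldI2)+
  show ?thesis
  proof (intro set_eqI iffI)
    fix K assume "K \<in> upsets (ord_sum r s)"
    moreover obtain I J where "K = I <+> J" using ex_Plus[of K] by blast
    ultimately show "K \<in> (\<lambda>I. I <+> Field s) ` upsets r \<union> (\<lambda>J. {} <+> J) ` upsets s" using e by auto
  qed (use e in auto)
qed

text \<open>Upper sets of the union are independent pairs of upper sets, and cutting along such a
  pair cuts each summand separately, so the sum factors.\<close>

lemma coprod_star_disj_union:
  assumes r: "fposet r" and s: "fposet s"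
  shows "coprod_star_of (disj_union r s) =
    (tmul prod_m (coprod_star_of r) (coprod_star_of s) :: 'k::field poset_space2)"
proof -
  let ?b = "\<lambda>r I. (iso_class (Restr r (Field r - I)), iso_class (Restr r I))"
  have "coprod_star_of (disj_union r s) =
    (\<Sum>(I, J)\<in>upsets r \<times> upsets s. basis (?b (disj_union r s) (I <+> J)) :: 'k poset_space2)"
    unfolding coprod_star_of_eq upsets_disj_union
    by (subst sum.reindex) (auto simp: inj_on_def Plus_eq_iff intro!: sum.cong)
  also have "\<dots> = (\<Sum>(I, J)\<in>upsets r \<times> upsets s. tmul prod_m (basis (?b r I)) (basis (?b s J)))"
  proof (rule sum.cong[OF refl], clarify)
    fix I J assume "I \<in> upsets r" "J \<in> upsets s"
    then have "I \<subseteq> Field r" "J \<subseteq> Field s" by (simp_all add: upsets_subset)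
    then show "basis (?b (disj_union r s) (I <+> J)) =
      (tmul prod_m (basis (?b r I)) (basis (?b s J)) :: 'k poset_space2)"
      by (simp add: tmul_basis prod_m_iso_class fposet_Restr r s Plus_diff Restr_disj_union
        tens_basis)
  qed
  also have "\<dots> = tmul prod_m (coprod_star_of r) (coprod_star_of s)"
    unfolding coprod_star_of_eq
    by (subst lin_of_sum[OF lin_tmul_left], subst lin_of_sum[OF lin_tmul_right],
        subst sum.cartesian_product) (rule refl)
  finally show ?thesis .
qed

text \<open>A cut at \<open>I <+> Field s\<close> leaves \<open>s\<close> whole in the right factor
  and gives the first term. A cut at \<open>{} <+> J\<close> leaves \<open>r\<close> whole in the
  left factor and gives the second. The cut exactly between the summands is of both kinds.\<close>

lemma coprod_star_ord_sum:
  assumes r: "fposet r" and s: "fposet s"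
  shows "coprod_star_of (ord_sum r s) =
    tmul prod_down (coprod_star_of r) (tens unit_poset (basis (iso_class s))) +
    tmul prod_down (tens (basis (iso_class r)) unit_poset) (coprod_star_of s) -
    (tens (basis (iso_class r)) (basis (iso_class s)) :: 'k::field poset_space2)"
proof -
  define b :: "('a + 'b) set \<Rightarrow> 'k poset_space2" where "b K = basis
    (iso_class (Restr (ord_sum r s) (Field (ord_sum r s) - K)),
      iso_class (Restr (ord_sum r s) K))" for K
  \<comment> \<open>The unit is written over both carrier types because the empty part of a cut may
    be a restriction of \<open>s\<close> or of \<open>r\<close>.\<close>
  have u: "unit_poset = (basis (iso_class ({} :: 'b rel)) :: 'k poset_space)"
    "unit_poset = (basis (iso_class ({} :: 'a rel)) :: 'k poset_space)"
    unfolding unit_poset_def by (rule arg_cong[where f = basis], rule iso_class_empty[symmetric])+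
  have b: "b (I <+> J) = basis (iso_class (ord_sum (Restr r (Field r - I)) (Restr s (Field s - J))),
      iso_class (ord_sum (Restr r I) (Restr s J)))" if "I \<subseteq> Field r" "J \<subseteq> Field s" for I J
    using that by (simp add: b_def Plus_diff Restr_ord_sum r s)
  have 1: "(\<Sum>K\<in>(\<lambda>I. I <+> Field s) ` upsets r. b K) =
    tmul prod_down (coprod_star_of r) (tens unit_poset (basis (iso_class s)))"
    unfolding coprod_star_of_eq lin_of_sum[OF lin_tmul_left]
  proof (subst sum.reindex, simp add: inj_on_def Plus_eq_iff, rule sum.cong[OF refl])
    fix I assume "I \<in> upsets r"
    then have "I \<subseteq> Field r" by (rule upsets_subset)
    then show "(b \<circ> (\<lambda>I. I <+> Field s)) I =
      tmul prod_down (basis (iso_class (Restr r (Field r - I)), iso_class (Restr r I)))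
        (tens unit_poset (basis (iso_class s)))"
      by (simp add: b u(1) tens_basis tmul_basis prod_down_iso_class r s fposet_Restr fposet_empty
        Restr_Field)
  qed
  have 2: "(\<Sum>K\<in>(\<lambda>J. {} <+> J) ` upsets s. b K) =
    tmul prod_down (tens (basis (iso_class r)) unit_poset) (coprod_star_of s)"
    unfolding coprod_star_of_eq lin_of_sum[OF lin_tmul_right]
  proof (subst sum.reindex, simp add: inj_on_def Plus_eq_iff, rule sum.cong[OF refl])
    fix J assume "J \<in> upsets s"
    then have "J \<subseteq> Field s" by (rule upsets_subset)
    then show "(b \<circ> (\<lambda>J. {} <+> J)) J =
      tmul prod_down (tens (basis (iso_class r)) unit_poset)
        (basis (iso_class (Restr s (Field s - J)), iso_class (Restr s J)))"
      by (simp add: b u(2) tens_basis tmul_basis prod_down_iso_class r s fposet_Restr fposet_empty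
        Restr_Field)
  qed
  have i: "(\<lambda>I. I <+> Field s) ` upsets r \<inter> (\<lambda>J. {} <+> J) ` upsets s = {{} <+> Field s}"
    using empty_in_upsets[of r] Field_in_upsets[of s] by (auto simp: Plus_eq_iff)
  have 3: "b ({} <+> Field s) = tens (basis (iso_class r)) (basis (iso_class s))"
    by (simp add: b ord_sum_empty iso_class_disj_union_empty Restr_Field r s tens_basis)
  have "coprod_star_of (ord_sum r s) = (\<Sum>K\<in>upsets (ord_sum r s). b K)"
    unfolding coprod_star_of_eq b_def ..
  \<comment> \<open>Inclusion-exclusion for the two families, whose only common member is given by
    \<open>i\<close>.\<close>
  also have "\<dots> = (\<Sum>K\<in>(\<lambda>I. I <+> Field s) ` upsets r. b K) + (\<Sum>K\<in>(\<lambda>J. {} <+> J) ` upsets s. b K)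
    - b ({} <+> Field s)"
    unfolding upsets_ord_sum
    by (subst sum_Un) (simp_all add: finite_upsets r s i)
  finally show ?thesis unfolding 1 2 3 .
qed

section \<open>The infinitesimal bialgebra and the bialgebra of the disjoint union\<close>

lemmas lin_product_intros = lin_intros lin_coproducts lin_compose[OF _ lin_coproducts(2)]
  bilin_lin(1,2)[OF bilin_products(1)] bilin_lin(1,2)[OF bilin_products(2)]

lemma infinitesimal_bialgebra_prod_down:
  "infinitesimal_bialgebra prod_down unit_poset coprod_star (counit :: 'k::field poset_space \<Rightarrow> 'k)"
proof -
  have "coprod_star (prod_down x y) = tmul prod_down (coprod_star x) (tens unit_poset y) +
    tmul prod_down (tens x unit_poset) (coprod_star y) - tens x y" for x y :: "'k poset_space"
  proof (rule bilin_eq_on_basis[where x = x and y = y])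
    fix p q
    obtain r s :: "nat rel" where "fposet r" "p = iso_class r" "fposet s" "q = iso_class s"
      using poset_class_cases[of p] poset_class_cases[of q] by metis
    then show "coprod_star (prod_down (basis p) (basis q)) =
      tmul prod_down (coprod_star (basis p)) (tens unit_poset (basis q)) +
      tmul prod_down (tens (basis p) unit_poset) (coprod_star (basis q)) -
      (tens (basis p) (basis q) :: 'k poset_space2)"
      by (simp add: prod_down_iso_class coprod_star_iso_class fposet_ord_sum coprod_star_ord_sum)
  qed (unfold bilin_def, (intro conjI allI lin_product_intros)+)
  then show ?thesis
    unfolding infinitesimal_bialgebra_def
    using unital_algebra_prod_down counital_coalgebra_coprod_star by blast
qed

lemma bialgebra_prod_m:
  "bialgebra prod_m unit_poset coprod_star (counit :: 'k::field poset_space \<Rightarrow> 'k)"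
proof -
  have 1: "coprod_star (prod_m x y) = tmul prod_m (coprod_star x) (coprod_star y)"
    for x y :: "'k poset_space"
  proof (rule bilin_eq_on_basis[where x = x and y = y])
    fix p q
    obtain r s :: "nat rel" where "fposet r" "p = iso_class r" "fposet s" "q = iso_class s"
      using poset_class_cases[of p] poset_class_cases[of q] by metis
    then show "coprod_star (prod_m (basis p) (basis q)) =
      (tmul prod_m (coprod_star (basis p)) (coprod_star (basis q)) :: 'k poset_space2)"
      by (simp add: prod_m_iso_class coprod_star_iso_class fposet_disj_union coprod_star_disj_union)
  qed (unfold bilin_def, (intro conjI allI lin_product_intros)+)
  have "upsets ({} :: nat rel) = {{}}" by (auto simp: upsets_iff)
  then have 2: "coprod_star unit_poset = (tens unit_poset unit_poset :: 'k poset_space2)"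
    by (simp add: unit_poset_def coprod_star_iso_class fposet_empty coprod_star_of_eq tens_basis)
  have 3: "counit (prod_m x y) = counit x * counit y" for x y :: "'k poset_space"
  proof (rule linf_eq_on_basis[where x = x])
    fix p
    show "counit (prod_m (basis p) y) = counit (basis p) * (counit y :: 'k)"
    proof (rule linf_eq_on_basis[where x = y])
      fix q
      obtain r s :: "nat rel" where rs: "fposet r" "p = iso_class r" "fposet s" "q = iso_class s"
        using poset_class_cases[of p] poset_class_cases[of q] by metis
      have "disj_union r s = {} \<longleftrightarrow> r = {} \<and> s = {}" by (auto simp: disj_union_def)
      with rs show "counit (prod_m (basis p) (basis q)) =
        counit (basis p) * (counit (basis q) :: 'k)"
        by (simp add: prod_m_iso_class counit_iso_class fposet_disj_union)
    qed (intro linf_cmult linf_compose[OF bilin_lin(1)[OF bilin_products(1)]] lin_coproducts)+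
  qed (intro linf_multc linf_compose[OF bilin_lin(2)[OF bilin_products(1)]] lin_coproducts)+
  show ?thesis
    unfolding bialgebra_def
    using unital_algebra_prod_m counital_coalgebra_coprod_star 1 2 3
      counit_iso_class[OF fposet_empty[where 'a = nat], where 'b = 'k]
    unfolding unit_poset_def by auto
qed

section \<open>Counting isomorphisms\<close>

text \<open>Extensionality identifies isomorphisms that agree on the carrier, so that the
  cardinality is their true number.\<close>

definition isos :: "'a rel \<Rightarrow> 'b rel \<Rightarrow> ('a \<Rightarrow> 'b) set" where
  "isos r s = {f \<in> extensional (Field r). is_iso r s f}"

lemma finite_isos:
  assumes "fposet r" "fposet s" shows "finite (isos r s)"
proof (rule finite_subset)
  show "isos r s \<subseteq> Field r \<rightarrow>\<^sub>E Field s"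
    by (auto simp: isos_def PiE_def dest: is_isoD(4))
  show "finite (Field r \<rightarrow>\<^sub>E Field s)" using assms by (simp add: finite_PiE fposet_def)
qed

text \<open>Composition with the inverse of one fixed isomorphism turns isomorphisms from
  \<open>r\<close> to \<open>s\<close> into automorphisms of \<open>r\<close>.\<close>

lemma card_isos:
  assumes "fposet r" "fposet s"
  shows "card (isos r s) = (if poset_iso r s then num_aut r else 0)"
proof (cases "poset_iso r s")
  case True
  then obtain f where f: "is_iso r s f" by (rule poset_isoE)
  obtain g where g: "is_iso s r g" "\<And>x. x \<in> Field r \<Longrightarrow> g (f x) = x" "\<And>y. y \<in> Field s \<Longrightarrow> f (g y) = y"
    by (rule is_iso_inverse[OF f]) (blast intro: that)
  have "bij_betw (\<lambda>h. restrict (\<lambda>x. g (h x)) (Field r)) (isos r s) (isos r r)"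
  proof (rule bij_betw_byWitness[where f' = "\<lambda>h. restrict (\<lambda>x. f (h x)) (Field r)"])
    show "\<forall>h\<in>isos r s. restrict (\<lambda>x. f (restrict (\<lambda>x. g (h x)) (Field r) x)) (Field r) = h"
      using g(3) by (auto simp: isos_def fun_eq_iff restrict_def extensional_def dest: is_isoD(4))
    show "\<forall>h\<in>isos r r. restrict (\<lambda>x. g (restrict (\<lambda>x. f (h x)) (Field r) x)) (Field r) = h"
      using g(2) by (auto simp: isos_def fun_eq_iff restrict_def extensional_def dest: is_isoD(4))
  qed (auto simp: isos_def is_iso_restrict intro: is_iso_comp[OF _ f] is_iso_comp[OF _ g(1)])
  then show ?thesis using True by (simp add: bij_betw_same_card num_aut_def isos_def)
next
  case False
  then have "isos r s = {}" using assms by (auto simp: isos_def poset_iso_def)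
  then show ?thesis using False by simp
qed

lemma pairing_card_isos:
  assumes "fposet r" "fposet s"
  shows "pairing (basis (iso_class r)) (basis (iso_class s)) = of_nat (card (isos r s))"
  by (simp add: pairing_iso_class card_isos assms)

text \<open>The bijections counted in both adjointness statements. They embed each summand
  separately; nothing is required of pairs from different summands.\<close>

definition glued :: "'a rel \<Rightarrow> 'b rel \<Rightarrow> 'c rel \<Rightarrow> ('a + 'b \<Rightarrow> 'c) set" where
  "glued r s t = {f \<in> extensional (Field r <+> Field s).
     bij_betw f (Field r <+> Field s) (Field t) \<and>
     (\<forall>x\<in>Field r. \<forall>y\<in>Field r. (f (Inl x), f (Inl y)) \<in> t \<longleftrightarrow> (x, y) \<in> r) \<and>
     (\<forall>x\<in>Field s. \<forall>y\<in>Field s. (f (Inr x), f (Inr y)) \<in> t \<longleftrightarrow> (x, y) \<in> s)}"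

lemma bij_betw_Plus_iff:
  "bij_betw f (A <+> B) C \<longleftrightarrow> (\<exists>J\<subseteq>C. bij_betw (f \<circ> Inl) A J \<and> bij_betw (f \<circ> Inr) B (C - J))"
proof
  assume f: "bij_betw f (A <+> B) C"
  have i: "inj_on f (A <+> B)" and e: "f ` Inl ` A \<union> f ` Inr ` B = C"
    using f unfolding bij_betw_def Plus_def by (auto simp: image_Un)
  have d: "f ` Inl ` A \<inter> f ` Inr ` B = {}"
    using inj_on_image_Int[OF i, of "Inl ` A" "Inr ` B"] by (auto simp: Plus_def)
  show "\<exists>J\<subseteq>C. bij_betw (f \<circ> Inl) A J \<and> bij_betw (f \<circ> Inr) B (C - J)"
  proof (intro exI conjI)
    show "f ` Inl ` A \<subseteq> C" using e by blast
    show "bij_betw (f \<circ> Inl) A (f ` Inl ` A)"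
      using i unfolding bij_betw_def by (auto simp: inj_on_def image_comp)
    have "C - f ` Inl ` A = f ` Inr ` B" using e d by blast
    then show "bij_betw (f \<circ> Inr) B (C - f ` Inl ` A)"
      using i unfolding bij_betw_def by (auto simp: inj_on_def image_comp)
  qed
next
  assume "\<exists>J\<subseteq>C. bij_betw (f \<circ> Inl) A J \<and> bij_betw (f \<circ> Inr) B (C - J)"
  then obtain J where J: "J \<subseteq> C" "inj_on (f \<circ> Inl) A" "inj_on (f \<circ> Inr) B"
    "f ` Inl ` A = J" "f ` Inr ` B = C - J" by (auto simp: bij_betw_def image_comp)
  have "f ` (A <+> B) = C" using J(1,4,5) unfolding Plus_def image_Un by blast
  moreover have "f (Inl a) \<noteq> f (Inr b)" if "a \<in> A" "b \<in> B" for a b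
    using J(4,5) that by blast
  then have "inj_on f (A <+> B)"
    using J(2,3) unfolding inj_on_def ball_Plus by (simp add: comp_def) metis
  ultimately show "bij_betw f (A <+> B) C" by (simp add: bij_betw_def)
qed

text \<open>For a bijection onto \<open>J\<close> the images lie in \<open>J\<close> anyway, so the
  order of \<open>t\<close> can replace its restriction.\<close>

lemma isos_Restr_iff:
  assumes "fposet t" "J \<subseteq> Field t"
  shows "f \<in> isos r (Restr t J) \<longleftrightarrow> f \<in> extensional (Field r) \<and> bij_betw f (Field r) J \<and>
    (\<forall>x\<in>Field r. \<forall>y\<in>Field r. (f x, f y) \<in> t \<longleftrightarrow> (x, y) \<in> r)"
proof -
  have "(f x, f y) \<in> Restr t J \<longleftrightarrow> (f x, f y) \<in> t"
    if "bij_betw f (Field r) J" "x \<in> Field r" "y \<in> Field r" for x y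
    using that by (auto dest: bij_betwE)
  then show ?thesis unfolding isos_def is_iso_def Field_Restr[OF assms] by auto
qed

text \<open>A glued map amounts to the image \<open>J\<close> of the first summand, an isomorphism
  from \<open>r\<close> onto \<open>J\<close> and one from \<open>s\<close> onto the complement. The
  family \<open>\<J>\<close> is left open: it becomes the complements of upper sets for one
  adjunction and the clopen sets for the other.\<close>

lemma card_glued:
  assumes r: "fposet r" and s: "fposet s" and t: "fposet t" and \<J>: "\<J> \<subseteq> Pow (Field t)"
  shows "card {f \<in> glued r s t. f ` Inl ` Field r \<in> \<J>} =
    (\<Sum>J\<in>\<J>. card (isos r (Restr t J)) * card (isos s (Restr t (Field t - J))))"
proof -
  define S where "S = Sigma \<J> (\<lambda>J. isos r (Restr t J) \<times> isos s (Restr t (Field t - J)))"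
  \<comment> \<open>Splitting and gluing are inverse to each other because \<open>restrict\<close>
    sets all values outside the carriers to the default \<open>undefined\<close>, as extensionality
    requires.\<close>
  let ?\<Phi> = "\<lambda>f. (f ` Inl ` Field r, restrict (f \<circ> Inl) (Field r), restrict (f \<circ> Inr) (Field s))"
  let ?\<Psi> = "\<lambda>(J, g, h). restrict (case_sum g h) (Field r <+> Field s)"
  have S: "(J, g, h) \<in> S \<longleftrightarrow> J \<in> \<J> \<and> g \<in> extensional (Field r) \<and> h \<in> extensional (Field s) \<and>
      bij_betw g (Field r) J \<and> bij_betw h (Field s) (Field t - J) \<and>
      (\<forall>x\<in>Field r. \<forall>y\<in>Field r. (g x, g y) \<in> t \<longleftrightarrow> (x, y) \<in> r) \<and>
      (\<forall>x\<in>Field s. \<forall>y\<in>Field s. (h x, h y) \<in> t \<longleftrightarrow> (x, y) \<in> s)" for J g h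
    using \<J> isos_Restr_iff[OF t, of J g r] isos_Restr_iff[OF t Diff_subset, of h s J]
    unfolding S_def by auto
  have "bij_betw ?\<Phi> {f \<in> glued r s t. f ` Inl ` Field r \<in> \<J>} S"
  proof (rule bij_betw_byWitness[where f' = ?\<Psi>])
    show "\<forall>f\<in>{f \<in> glued r s t. f ` Inl ` Field r \<in> \<J>}. ?\<Psi> (?\<Phi> f) = f"
    proof
      fix f assume "f \<in> {f \<in> glued r s t. f ` Inl ` Field r \<in> \<J>}"
      then have "f \<in> extensional (Field r <+> Field s)" by (simp add: glued_def)
      then show "?\<Psi> (?\<Phi> f) = f"
        by (intro extensionalityI[of _ "Field r <+> Field s"]) auto
    qed
    show "\<forall>p\<in>S. ?\<Phi> (?\<Psi> p) = p"
    proof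
      fix p assume "p \<in> S"
      moreover obtain J g h where p: "p = (J, g, h)" by (cases p)
      ultimately have e: "g \<in> extensional (Field r)" "h \<in> extensional (Field s)" "g ` Field r = J"
        by (simp_all add: S bij_betw_def)
      have "restrict (case_sum g h) (Field r <+> Field s) ` Inl ` Field r = g ` Field r"
        unfolding image_image by (rule image_cong) simp_all
      moreover have "restrict (restrict (case_sum g h) (Field r <+> Field s) \<circ> Inl) (Field r) = g"
        by (rule extensionalityI[OF restrict_extensional e(1)]) simp
      moreover have "restrict (restrict (case_sum g h) (Field r <+> Field s) \<circ> Inr) (Field s) = h"
        by (rule extensionalityI[OF restrict_extensional e(2)]) simp
      ultimately show "?\<Phi> (?\<Psi> p) = p" by (simp add: p e(3))
    qed
    show "?\<Phi> ` {f \<in> glued r s t. f ` Inl ` Field r \<in> \<J>} \<subseteq> S"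
    proof clarify
      fix f assume f: "f \<in> glued r s t" "f ` Inl ` Field r \<in> \<J>"
      then obtain J where J: "J \<subseteq> Field t" "bij_betw (f \<circ> Inl) (Field r) J"
        "bij_betw (f \<circ> Inr) (Field s) (Field t - J)"
        unfolding glued_def bij_betw_Plus_iff by blast
      then have e: "f ` Inl ` Field r = J" by (simp add: bij_betw_def image_comp)
      have "bij_betw (restrict (f \<circ> Inl) (Field r)) (Field r) J"
        "bij_betw (restrict (f \<circ> Inr) (Field s)) (Field s) (Field t - J)"
        using J(2,3) bij_betw_cong[of "Field r" "restrict (f \<circ> Inl) (Field r)" "f \<circ> Inl"]
          bij_betw_cong[of "Field s" "restrict (f \<circ> Inr) (Field s)" "f \<circ> Inr"] by simp_all
      then show "?\<Phi> f \<in> S" using f unfolding S e glued_def by simp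
    qed
    show "?\<Psi> ` S \<subseteq> {f \<in> glued r s t. f ` Inl ` Field r \<in> \<J>}"
    proof
      fix f assume "f \<in> ?\<Psi> ` S"
      then obtain J g h where p: "(J, g, h) \<in> S"
        "f = restrict (case_sum g h) (Field r <+> Field s)" by auto
      have c: "bij_betw (f \<circ> Inl) (Field r) J \<longleftrightarrow> bij_betw g (Field r) J"
        "bij_betw (f \<circ> Inr) (Field s) (Field t - J) \<longleftrightarrow> bij_betw h (Field s) (Field t - J)"
        by (rule bij_betw_cong; simp add: p(2))+
      have e: "f ` Inl ` Field r = J" using p(1) unfolding S c(1)[symmetric]
        by (simp add: bij_betw_def image_comp)
      have "bij_betw f (Field r <+> Field s) (Field t)"
        unfolding bij_betw_Plus_iff using p(1) \<J> unfolding S c[symmetric] by blast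
      then show "f \<in> {f \<in> glued r s t. f ` Inl ` Field r \<in> \<J>}"
        using p(1) unfolding S by (simp add: glued_def e) (simp add: p(2))
    qed
  qed
  then have "card {f \<in> glued r s t. f ` Inl ` Field r \<in> \<J>} = card S" by (rule bij_betw_same_card)
  also have "\<dots> = (\<Sum>J\<in>\<J>. card (isos r (Restr t J)) * card (isos s (Restr t (Field t - J))))"
  proof -
    have "finite \<J>" using t \<J> by (auto simp: fposet_def intro: finite_subset)
    moreover have "finite (isos r (Restr t J))" "finite (isos s (Restr t (Field t - J)))"
      if "J \<in> \<J>" for J
      using that \<J> by (auto intro!: finite_isos fposet_Restr r s t)
    ultimately show ?thesis unfolding S_def
      by (subst card_SigmaI) (auto simp: card_cartesian_product)
  qed
  finally show ?thesis .
qed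

text \<open>In a star order the second summand is an upper set, and isomorphisms preserve this.
  Conversely, a glued map of this kind becomes an isomorphism when the order of \<open>t\<close> is
  pulled back along it.\<close>

lemma UN_isos_star_orders:
  assumes r: "fposet r" and s: "fposet s" and t: "fposet t"
  shows "(\<Union>t'\<in>star_orders r s. isos t' t) =
    {f \<in> glued r s t. f ` Inl ` Field r \<in> (\<lambda>I. Field t - I) ` upsets t}"
proof (intro set_eqI iffI)
  fix f assume "f \<in> (\<Union>t'\<in>star_orders r s. isos t' t)"
  then obtain t' where t': "t' \<in> star_orders r s"
    and f: "f \<in> extensional (Field t')" "is_iso t' t f"
    by (auto simp: isos_def)
  note T = t'[unfolded star_orders_iff]
  note i = is_isoD[OF f(2)]
  have F: "Field t' = Field r <+> Field s" using T by blast
  have "f ` Inr ` Field s \<in> upsets t"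
    unfolding upsets_iff
  proof (intro conjI ballI allI impI)
    show "f ` Inr ` Field s \<subseteq> Field t" using i(4) F by auto
    fix x y assume "x \<in> f ` Inr ` Field s" and xy: "(x, y) \<in> t"
    then obtain b where b: "b \<in> Field s" "x = f (Inr b)" by blast
    obtain z where z: "z \<in> Field t'" "y = f z" using FieldI2[OF xy] i(3) by blast
    have "(Inr b, z) \<in> t'" using xy i(5)[of "Inr b" z] b z F by simp
    \<comment> \<open>No relation leads from \<open>Inr b\<close> to the first summand, so
      \<open>z\<close> must come from the second.\<close>
    then show "y \<in> f ` Inr ` Field s" using z T b(1) F by (cases z) auto
  qed
  moreover have "f ` Inl ` Field r = Field t - f ` Inr ` Field s"
  proof -
    have "Inl ` Field r = Field t' - Inr ` Field s" "Inr ` Field s \<subseteq> Field t'"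
      unfolding F by auto
    then show ?thesis using inj_on_image_set_diff[OF i(2) Diff_subset] i(3) by simp
  qed
  moreover have "f \<in> glued r s t"
    using f(1) i(1,5) T unfolding glued_def F by auto
  ultimately show "f \<in> {f \<in> glued r s t. f ` Inl ` Field r \<in> (\<lambda>I. Field t - I) ` upsets t}" by blast
next
  fix f assume "f \<in> {f \<in> glued r s t. f ` Inl ` Field r \<in> (\<lambda>I. Field t - I) ` upsets t}"
  then obtain I where f: "f \<in> glued r s t" and I: "I \<in> upsets t" "f ` Inl ` Field r = Field t - I"
    by blast
  let ?F = "Field r <+> Field s"
  \<comment> \<open>The only order on the sum for which \<open>f\<close> is an isomorphism to
    \<open>t\<close>.\<close>
  define t' where "t' = {(x, y). x \<in> ?F \<and> y \<in> ?F \<and> (f x, f y) \<in> t}"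
  have b: "bij_betw f ?F (Field t)" using f by (simp add: glued_def)
  have F: "Field t' = ?F"
  proof
    show "Field t' \<subseteq> ?F" by (auto simp: t'_def Field_def)
    have "(x, x) \<in> t'" if "x \<in> ?F" for x
      using fposetD(1)[OF t] bij_betwE[OF b] that by (simp add: t'_def)
    then show "?F \<subseteq> Field t'" by (blast intro: FieldI1)
  qed
  have i: "is_iso t' t f"
    by (rule is_isoI) (use b F in \<open>auto simp: t'_def\<close>)
  \<comment> \<open>The poset axioms are transported from \<open>t\<close>, hence along the inverse
    of \<open>f\<close>.\<close>
  obtain g where "is_iso t t' g" by (rule is_iso_inverse[OF i])
  then have "fposet t'" by (rule fposet_is_iso[OF t])
  then have po: "Partial_order t'" by (simp add: fposet_def)
  have "(Inr b, Inl a) \<notin> t'" if ab: "a \<in> Field r" "b \<in> Field s" for a b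
  proof
    assume "(Inr b, Inl a) \<in> t'"
    then have 1: "(f (Inr b), f (Inl a)) \<in> t" by (simp add: t'_def)
    have "f (Inl a) \<notin> I" using I(2) ab(1) by blast
    with 1 have "f (Inr b) \<notin> I" using I(1) unfolding upsets_iff by blast
    then have "f (Inr b) \<in> f ` Inl ` Field r" using bij_betwE[OF b] ab(2) I(2) by auto
    then show False using bij_betw_imp_inj_on[OF b] ab(2) by (auto simp: inj_on_def)
  qed
  moreover have "(Inl x, Inl y) \<in> t' \<longleftrightarrow> (x, y) \<in> r" if "x \<in> Field r" "y \<in> Field r" for x y
    using f that by (simp add: t'_def glued_def)
  moreover have "(Inr x, Inr y) \<in> t' \<longleftrightarrow> (x, y) \<in> s" if "x \<in> Field s" "y \<in> Field s" for x y
    using f that by (simp add: t'_def glued_def)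
  ultimately have "t' \<in> star_orders r s" unfolding star_orders_iff using F po by blast
  moreover have "f \<in> isos t' t" using f i by (simp add: isos_def glued_def F)
  ultimately show "f \<in> (\<Union>t'\<in>star_orders r s. isos t' t)" by blast
qed

lemma finite_star_orders:
  assumes "fposet r" "fposet s" shows "finite (star_orders r s)"
proof (rule finite_subset)
  show "star_orders r s \<subseteq> Pow ((Field r <+> Field s) \<times> (Field r <+> Field s))"
  proof clarify
    fix t x y assume t: "t \<in> star_orders r s" and xy: "(x, y) \<in> t"
    have "Field t = Field r <+> Field s" using t by (simp add: star_orders_iff)
    then show "x \<in> Field r <+> Field s \<and> y \<in> Field r <+> Field s"
      using FieldI1[OF xy] FieldI2[OF xy] by simp
  qed
qed (use assms in \<open>simp add: fposet_def\<close>)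

text \<open>An isomorphism to \<open>t\<close> determines the order on its source, so distinct star
  orders have disjoint sets of isomorphisms. The sum therefore counts their union, which consists of
  glued maps.\<close>

lemma sum_card_isos_star_orders:
  assumes r: "fposet r" and s: "fposet s" and t: "fposet t"
  shows "(\<Sum>t'\<in>star_orders r s. card (isos t' t)) =
    (\<Sum>I\<in>upsets t. card (isos r (Restr t (Field t - I))) * card (isos s (Restr t I)))"
proof -
  have "isos t1 t \<inter> isos t2 t = {}"
    if t1: "t1 \<in> star_orders r s" and t2: "t2 \<in> star_orders r s" and "t1 \<noteq> t2" for t1 t2
  proof (rule ccontr)
    assume "isos t1 t \<inter> isos t2 t \<noteq> {}"
    then obtain f where f: "is_iso t1 t f" "is_iso t2 t f" by (auto simp: isos_def)
    have F: "Field t1 = Field t2" using t1 t2 by (simp add: star_orders_iff)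
    have "(x, y) \<in> t1 \<longleftrightarrow> (x, y) \<in> t2" for x y
      using is_isoD(5)[OF f(1), of x y] is_isoD(5)[OF f(2), of x y] F
      by (metis FieldI1 FieldI2)
    then show False using \<open>t1 \<noteq> t2\<close> by auto
  qed
  then have "(\<Sum>t'\<in>star_orders r s. card (isos t' t)) = card (\<Union>t'\<in>star_orders r s. isos t' t)"
    by (subst card_UN_disjoint)
      (auto simp: finite_star_orders r s intro!: finite_isos t fposet_star_orders[OF _ r s])
  also have "\<dots> = (\<Sum>J\<in>(\<lambda>I. Field t - I) ` upsets t.
      card (isos r (Restr t J)) * card (isos s (Restr t (Field t - J))))"
    unfolding UN_isos_star_orders[OF assms] by (rule card_glued[OF assms]) auto
  also have "\<dots> = (\<Sum>I\<in>upsets t. card (isos r (Restr t (Field t - I))) * card (isos s (Restr t I)))"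
  \<comment> \<open>Complementation is an involution on subsets of the carrier and replaces the
    image of the first summand by the upper set of the cut.\<close>
  proof (subst sum.reindex)
    show "inj_on (\<lambda>I. Field t - I) (upsets t)"
      by (rule inj_on_inverseI[where g = "\<lambda>I. Field t - I"]) (auto dest: upsets_subset)
    show "sum ((\<lambda>J. card (isos r (Restr t J)) * card (isos s (Restr t (Field t - J)))) \<circ>
        (\<lambda>I. Field t - I)) (upsets t) =
      (\<Sum>I\<in>upsets t. card (isos r (Restr t (Field t - I))) * card (isos s (Restr t I)))"
    proof (rule sum.cong[OF refl])
      fix I assume "I \<in> upsets t"
      then have "Field t - (Field t - I) = I" by (auto dest: upsets_subset)
      then show "((\<lambda>J. card (isos r (Restr t J)) * card (isos s (Restr t (Field t - J)))) \<circ>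
        (\<lambda>I. Field t - I)) I =
        card (isos r (Restr t (Field t - I))) * card (isos s (Restr t I))" by simp
    qed
  qed
  finally show ?thesis .
qed

section \<open>The coproduct by connected components\<close>

text \<open>The clopen sets of the topology whose open sets are the upper sets.\<close>

definition clopens :: "'a rel \<Rightarrow> 'a set set" where
  "clopens r = {J \<in> upsets r. Field r - J \<in> upsets r}"

lemma clopens_iff:
  "J \<in> clopens r \<longleftrightarrow> J \<subseteq> Field r \<and> (\<forall>x y. (x, y) \<in> r \<longrightarrow> x \<in> J \<longleftrightarrow> y \<in> J)"
proof -
  have "x \<in> Field r \<and> y \<in> Field r" if "(x, y) \<in> r" for x y
    using that by (auto intro: FieldI1 FieldI2)
  then show ?thesis unfolding clopens_def upsets_iff by blast
qed

abbreviation conn :: "'a rel \<Rightarrow> 'a rel" where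
  "conn r \<equiv> (hasse r \<union> (hasse r)\<inverse>)\<^sup>*"

text \<open>Each edge of the Hasse diagram is a relation and cannot leave a clopen set in either
  direction; this propagates along paths.\<close>

lemma clopens_conn:
  assumes "J \<in> clopens r" "(x, y) \<in> conn r"
  shows "x \<in> J \<longleftrightarrow> y \<in> J"
  using assms(2)
  by (induction rule: rtrancl_induct) (use assms(1) in \<open>auto simp: hasse_def clopens_iff\<close>)

lemma conn_sym: "(x, y) \<in> conn r \<Longrightarrow> (y, x) \<in> conn r"
  by (rule symD[OF sym_rtrancl]) (auto simp: sym_def)

lemma component_eq:
  assumes "C \<in> components r" "x \<in> C" shows "C = {y \<in> Field r. (x, y) \<in> conn r}"
proof -
  obtain w where w: "C = {y \<in> Field r. (w, y) \<in> conn r}"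
    using assms(1) unfolding components_iff by blast
  then have "(w, x) \<in> conn r" using assms(2) by blast
  then have "(w, y) \<in> conn r \<longleftrightarrow> (x, y) \<in> conn r" for y
    using conn_sym[of w x r] rtrancl_trans by metis
  then show ?thesis unfolding w by simp
qed

lemma in_component:
  assumes "x \<in> Field r" obtains C where "C \<in> components r" "x \<in> C"
proof
  show "{y \<in> Field r. (x, y) \<in> conn r} \<in> components r" using assms unfolding components_iff by blast
qed (use assms in simp)

lemma components_disjoint: "C \<in> components r \<Longrightarrow> C' \<in> components r \<Longrightarrow> x \<in> C \<Longrightarrow> x \<in> C' \<Longrightarrow> C = C'"
  using component_eq[of C r x] component_eq[of C' r x] by simp

lemma Union_components_diff:
  assumes "I \<subseteq> components r" shows "\<Union>(components r - I) = Field r - \<Union>I"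
proof (intro set_eqI iffI)
  fix x assume "x \<in> \<Union>(components r - I)"
  then obtain C where "C \<in> components r" "C \<notin> I" "x \<in> C" by blast
  then show "x \<in> Field r - \<Union>I" using components_disjoint[of C r _ x] assms components_subset
    by blast
next
  fix x assume "x \<in> Field r - \<Union>I"
  then show "x \<in> \<Union>(components r - I)" using in_component[of x r] by blast
qed

text \<open>A clopen set contains the component of each of its elements. A union of components is
  clopen because, by finiteness, every relation is a path of covering relations.\<close>

lemma bij_betw_Union_components:
  assumes "fposet r" shows "bij_betw Union (Pow (components r)) (clopens r)"
proof (rule bij_betw_byWitness[where f' = "\<lambda>J. {C \<in> components r. C \<subseteq> J}"])
  show "\<forall>I\<in>Pow (components r). {C \<in> components r. C \<subseteq> \<Union>I} = I"
  proof (intro ballI set_eqI iffI)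
    fix I C assume I: "I \<in> Pow (components r)" and C: "C \<in> {C \<in> components r. C \<subseteq> \<Union>I}"
    \<comment> \<open>Components are non-empty and pairwise disjoint, so a component covered by the
      union of \<open>I\<close> meets a member of \<open>I\<close> and equals it.\<close>
    then obtain x where "x \<in> C" using components_iff[of C r] by auto
    then show "C \<in> I" using C I components_disjoint[of C r _ x] by blast
  qed auto
  show "\<forall>J\<in>clopens r. \<Union>{C \<in> components r. C \<subseteq> J} = J"
  proof (intro ballI set_eqI iffI)
    fix J x assume J: "J \<in> clopens r" and x: "x \<in> J"
    then have "x \<in> Field r" by (auto simp: clopens_iff)
    then obtain C where C: "C \<in> components r" "x \<in> C" by (rule in_component)
    then have "C \<subseteq> J" using clopens_conn[OF J] x component_eq[OF C] by blast
    then show "x \<in> \<Union>{C \<in> components r. C \<subseteq> J}" using C by blast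
  qed auto
  show "Union ` Pow (components r) \<subseteq> clopens r"
  proof clarify
    fix I assume I: "I \<subseteq> components r"
    have "x \<in> \<Union>I \<longleftrightarrow> y \<in> \<Union>I" if xy: "(x, y) \<in> r" for x y
    proof -
      have "(hasse r)\<^sup>* \<subseteq> conn r" by (rule rtrancl_mono) blast
      then have c: "(x, y) \<in> conn r" using in_rtrancl_hasse[OF assms xy] by blast
      have F: "x \<in> Field r" "y \<in> Field r" using xy by (auto intro: FieldI1 FieldI2)
      show ?thesis
        using component_eq[of _ r x] component_eq[of _ r y] c conn_sym[OF c] F I by blast
    qed
    moreover have "\<Union>I \<subseteq> Field r" using I components_subset by blast
    ultimately show "\<Union>I \<in> clopens r" by (simp add: clopens_iff)
  qed
qed auto

text \<open>Indexing by clopen sets instead of sets of components gives the sum the shape produced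
  by \<open>card_glued\<close>.\<close>

lemma coprod_of_eq:
  assumes "fposet r"
  shows "(coprod_of r :: 'k::field poset_space2) =
    (\<Sum>J\<in>clopens r. basis (iso_class (Restr r J), iso_class (Restr r (Field r - J))))"
proof -
  have "(coprod_of r :: 'k poset_space2) =
    (\<Sum>I\<in>Pow (components r). basis (iso_class (Restr r (\<Union>I)), iso_class (Restr r (Field r - \<Union>I))))"
    unfolding coprod_of_def
  proof (rule sum.cong[OF refl])
    fix I assume "I \<in> Pow (components r)"
    then have I: "I \<subseteq> components r" by blast
    show "basis (iso_class (\<Union>C\<in>I. Restr r C), iso_class (\<Union>C\<in>components r - I. Restr r C)) =
      basis (iso_class (Restr r (\<Union>I)), iso_class (Restr r (Field r - \<Union>I)))"
      unfolding UN_components_Restr[OF assms I] UN_components_Restr[OF assms Diff_subset]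
        Union_components_diff[OF I] ..
  qed
  then show ?thesis
    by (simp only: sum.reindex_bij_betw[OF bij_betw_Union_components[OF assms],
          of "\<lambda>J. basis (iso_class (Restr r J), iso_class (Restr r (Field r - J)))"])
qed

text \<open>Given a glued map, the remaining condition for an isomorphism is that \<open>t\<close>
  has no relations between the images of the two summands, that is, that the first image is
  clopen.\<close>

lemma isos_disj_union:
  "isos (disj_union r s) t = {f \<in> glued r s t. f ` Inl ` Field r \<in> clopens t}"
proof (intro set_eqI)
  fix f
  let ?F = "Field r <+> Field s"
  show "f \<in> isos (disj_union r s) t \<longleftrightarrow> f \<in> {f \<in> glued r s t. f ` Inl ` Field r \<in> clopens t}"
  proof (cases "bij_betw f ?F (Field t)")
    case True
    have inj: "f x = f y \<longleftrightarrow> x = y" if "x \<in> ?F" "y \<in> ?F" for x y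
      using bij_betw_imp_inj_on[OF True] that by (auto simp: inj_on_def)
    have onto: "\<exists>x\<in>?F. y = f x" if "y \<in> Field t" for y using True that by (auto simp: bij_betw_def)
    have into: "f x \<in> Field t" if "x \<in> ?F" for x using True that by (auto dest: bij_betwE)
    have "f ` Inl ` Field r \<in> clopens t \<longleftrightarrow>
      (\<forall>a\<in>Field r. \<forall>b\<in>Field s. (f (Inl a), f (Inr b)) \<notin> t \<and> (f (Inr b), f (Inl a)) \<notin> t)"
      (is "?L \<longleftrightarrow> ?R")
    proof
      assume L: ?L
      have "f (Inr b) \<notin> f ` Inl ` Field r" if "b \<in> Field s" for b
        using inj that by auto
      with L show ?R unfolding clopens_iff by blast
    next
      assume R: ?R
      have "x \<in> f ` Inl ` Field r \<longleftrightarrow> y \<in> f ` Inl ` Field r" if xy: "(x, y) \<in> t" for x y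
      proof -
        obtain u v where "u \<in> ?F" "x = f u" "v \<in> ?F" "y = f v"
          using onto[OF FieldI1[OF xy]] onto[OF FieldI2[OF xy]] by blast
        then show ?thesis using R xy inj by (cases u; cases v) auto
      qed
      then show ?L unfolding clopens_iff using into by auto
    qed
    then show ?thesis using True
      by (auto simp: isos_def glued_def is_iso_def ball_Plus)
  next
    case False
    then show ?thesis by (simp add: isos_def glued_def is_iso_def)
  qed
qed

lemma card_isos_disj_union:
  assumes "fposet r" "fposet s" "fposet t"
  shows "card (isos (disj_union r s) t) =
    (\<Sum>J\<in>clopens t. card (isos r (Restr t J)) * card (isos s (Restr t (Field t - J))))"
  unfolding isos_disj_union by (rule card_glued[OF assms]) (auto simp: clopens_iff)

section \<open>Adjointness\<close>

definition aut_weight :: "poset_class \<Rightarrow> 'k::field" where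
  "aut_weight p = of_nat (num_aut (rep_poset_class p))"

lemma pairing_eq_dform: "pairing = dform aut_weight"
  unfolding pairing_def dform_def aut_weight_def ..

lemma dform_card_isos:
  assumes "fposet r" "fposet s"
  shows "dform aut_weight (basis (iso_class r)) (basis (iso_class s)) = of_nat (card (isos r s))"
  using pairing_card_isos[OF assms] by (simp add: pairing_eq_dform)

text \<open>The identity is an automorphism, so the count is positive, and in characteristic zero it
  stays nonzero in the field.\<close>

lemma aut_weight_nonzero: "aut_weight p \<noteq> (0 :: 'k::field_char_0)"
proof -
  let ?r = "rep_poset_class p"
  have "finite (isos ?r ?r)" by (intro finite_isos fposet_rep)
  moreover have "restrict (\<lambda>x. x) (Field ?r) \<in> isos ?r ?r"
    by (simp add: isos_def is_iso_restrict is_iso_def bij_betw_def)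
  ultimately show ?thesis
    unfolding aut_weight_def num_aut_def isos_def[symmetric] by (auto simp: card_eq_0_iff)
qed

text \<open>Factoring \<open>M\<close> through the tensor product merges \<open>x\<close> and
  \<open>y\<close> into one argument, so that \<open>adjoint_on_basis\<close> applies.\<close>

lemma product_adjoint_on_basis:
  assumes M: "bilin M" and D: "lin D"
    and b: "\<And>a b c. dform w (M (basis a) (basis b)) (basis c) =
      dform (wprod w w) (tens (basis a) (basis b)) (D (basis c))"
  shows "dform w (M x y) z = dform (wprod w w) (tens x y) (D z)"
proof -
  have "adjoint_wrt (wprod w w) w (mul_lin M) D"
  proof (rule adjoint_on_basis[OF lin_mul_lin D])
    fix ab c
    show "dform w (mul_lin M (basis ab)) (basis c) = dform (wprod w w) (basis ab) (D (basis c))"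
      using b by (cases ab) (simp add: mul_lin_def tens_basis)
  qed
  then show ?thesis by (simp add: adjoint_wrt_def mul_lin_tens[OF M, symmetric])
qed

lemma dform_sum_left: "dform w (sum f A) y = (\<Sum>a\<in>A. dform w (f a) y)"
  and dform_sum_right: "dform w x (sum f A) = (\<Sum>a\<in>A. dform w x (f a))"
  by (rule linf_of_sum[OF linf_dform(2)], rule linf_of_sum[OF linf_dform(1)])

text \<open>On basis elements the two sides expand to the two counts of
  \<open>sum_card_isos_star_orders\<close>.\<close>

lemma prod_star_adjoint:
  "dform aut_weight (prod_star x y) z =
    dform (wprod aut_weight aut_weight) (tens x y) (coprod_star z :: 'k::field poset_space2)"
proof (rule product_adjoint_on_basis[OF bilin_products(3) lin_coproducts(2)])
  fix p q p'
  obtain r s t :: "nat rel" where R: "fposet r" "p = iso_class r" "fposet s" "q = iso_class s"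
    "fposet t" "p' = iso_class t"
    using poset_class_cases[of p] poset_class_cases[of q] poset_class_cases[of p'] by metis
  have "dform aut_weight (prod_star (basis p) (basis q)) (basis p') =
    (of_nat (\<Sum>t'\<in>star_orders r s. card (isos t' t)) :: 'k)"
    unfolding R(2,4,6) prod_star_iso_class[OF R(1,3)] dform_sum_left of_nat_sum
    by (intro sum.cong refl dform_card_isos fposet_star_orders[OF _ R(1,3)] R(5))
  also have "\<dots> =
    dform (wprod aut_weight aut_weight) (tens (basis p) (basis q)) (coprod_star (basis p'))"
    unfolding sum_card_isos_star_orders[OF R(1,3,5)] R(2,4,6) coprod_star_iso_class[OF R(5)]
      coprod_star_of_eq dform_sum_right of_nat_sum
    by (intro sum.cong refl)
      (simp add: dform_tens_basis dform_card_isos R(1,3,5) fposet_Restr upsets_subset)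
  finally show "dform aut_weight (prod_star (basis p) (basis q)) (basis p') =
    (dform (wprod aut_weight aut_weight) (tens (basis p) (basis q)) (coprod_star (basis p')) :: 'k)" .
qed

text \<open>On basis elements the two sides expand to the two counts of
  \<open>card_isos_disj_union\<close>.\<close>

lemma prod_m_adjoint:
  "dform aut_weight (prod_m x y) z =
    dform (wprod aut_weight aut_weight) (tens x y) (coprod z :: 'k::field poset_space2)"
proof (rule product_adjoint_on_basis[OF bilin_products(1) lin_coproducts(1)])
  fix p q p'
  obtain r s t :: "nat rel" where R: "fposet r" "p = iso_class r" "fposet s" "q = iso_class s"
    "fposet t" "p' = iso_class t"
    using poset_class_cases[of p] poset_class_cases[of q] poset_class_cases[of p'] by metis
  have "dform aut_weight (prod_m (basis p) (basis q)) (basis p') =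
    (of_nat (card (isos (disj_union r s) t)) :: 'k)"
    unfolding R(2,4,6) prod_m_iso_class[OF R(1,3)]
    by (intro dform_card_isos fposet_disj_union R)
  also have "\<dots> = dform (wprod aut_weight aut_weight) (tens (basis p) (basis q)) (coprod (basis p'))"
    unfolding card_isos_disj_union[OF R(1,3,5)] R(2,4,6) coprod_iso_class[OF R(5)]
      coprod_of_eq[OF R(5)] dform_sum_right of_nat_sum
    by (intro sum.cong refl)
      (simp add: dform_tens_basis dform_card_isos R(1,3,5) fposet_Restr clopens_iff)
  finally show "dform aut_weight (prod_m (basis p) (basis q)) (basis p') =
    (dform (wprod aut_weight aut_weight) (tens (basis p) (basis q)) (coprod (basis p')) :: 'k)" .
qed

text \<open>Only the empty poset is isomorphic to the empty poset, and by exactly one map. This is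
  the link between unit and counit that \<open>dual_bialgebra\<close> requires.\<close>

lemma dform_unit_poset: "dform aut_weight unit_poset x = (counit x :: 'k::field)"
proof (rule linf_eq_on_basis[OF linf_dform(1) lin_coproducts(3)])
  fix p
  obtain r :: "nat rel" where r: "fposet r" "p = iso_class r" by (rule poset_class_cases)
  \<comment> \<open>The only extensional function on the empty carrier is constantly
    \<open>undefined\<close>.\<close>
  have "isos ({} :: nat rel) r = (if r = {} then {\<lambda>x. undefined} else {})" for r :: "nat rel"
    by (auto simp: isos_def is_iso_iff)
  then show "dform aut_weight unit_poset (basis p) = (counit (basis p) :: 'k)"
    by (simp add: unit_poset_def r dform_card_isos fposet_empty counit_iso_class)
qed

theorem theorem15:
  shows "dual_bialgebras (pairing :: 'k::field_char_0 poset_space \<Rightarrow> 'k poset_space \<Rightarrow> 'k)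
           prod_star unit_poset coprod counit
           prod_m unit_poset coprod_star counit
       \<and> infinitesimal_bialgebra
           (prod_down :: 'k poset_space \<Rightarrow> 'k poset_space \<Rightarrow> 'k poset_space)
           unit_poset coprod_star counit"
proof -
  have "bialgebra prod_star unit_poset coprod (counit :: 'k poset_space \<Rightarrow> 'k)"
    by (rule dual_bialgebra[OF aut_weight_nonzero bialgebra_prod_m bilin_products(3)
          lin_coproducts(1) prod_star_adjoint prod_m_adjoint dform_unit_poset])
  then show ?thesis
    \<comment> \<open>Pairing and tensor form are rewritten as diagonal forms, for which the two
      adjunctions were shown.\<close>
    unfolding dual_bialgebras_def pairing_eq_dform tform_dform
    using bialgebra_prod_m prod_star_adjoint prod_m_adjoint infinitesimal_bialgebra_prod_down
    by blast
qed

end
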